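(* Let $M$ be a complete metric space with at least two points and with a distinguished point $0\in M$, and let $\mathcal{F}(M)$ be its Lipschitz-free space. The following assertions are equivalent: (1) $M$ is a length space; (2) $\mathcal{F}(M)$ has the Daugavet property; (3) $\mathcal{F}(M)$ has the strong diameter two property (SD2P); (4) $\mathcal{F}(M)$ has the diameter two property (D2P); (5) $\mathcal{F}(M)$ has the local diameter two property (LD2P); (6) $\mathcal{F}(M)$ has the attaining strong diameter two property (ASD2P); (7) $\mathcal{F}(M)$ has the attaining diameter two property (AD2P); (8) $\mathcal{F}(M)$ has the attaining local diameter two property (ALD2P).
   Context: All Banach spaces are real. For a Banach space $X$, $B_X$ is the closed unit ball, $S_X$ the unit sphere, $X^*$ the dual space. Lipschitz-free space: for a metric space $(M,d)$ with distinguished point $0\in M$, $\operatorname{Lip}_0(M)$ is the Banach space of all real-valued Lipschitz functions on $M$ vanishing at $0$, with norm $\|f\|=\sup\{|f(p)-f(q)|/d(p,q): p,q\in M,\ p\neq q\}$. Let $\delta\colon M\to \operatorname{Lip}_0(M)^*$ be given by $\langle f,\delta(p)\rangle=f(p)$. Then $\mathcal{F}(M)$ is the norm-closed linear span of $\delta(M)$ in $\operatorname{Lip}_0(M)^*$, with the inherited norm; it is a predual of $\operatorname{Lip}_0(M)$, i.e. $\mathcal{F}(M)^*=\operatorname{Lip}_0(M)$ isometrically via the pairing $\langle f,\mu\rangle=\mu(f)$ for $f\in\operatorname{Lip}_0(M)$ and $\mu\in\mathcal{F}(M)\subset\operatorname{Lip}_0(M)^*$ (so that $\langle f,\delta(p)\rangle=f(p)$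 for $p\in M$). Length space: a path joining $p$ and $q$ is a continuous map $\gamma\colon[0,1]\to M$ with $\gamma(0)=p$, $\gamma(1)=q$; its length is $L(\gamma)=\sup\{\sum_{i=0}^{n-1} d(\gamma(t_i),\gamma(t_{i+1})): n\in\mathbb{N},\ 0=t_0\le\dots\le t_n=1\}$. $M$ is a length space if for all $p,q\in M$, $d(p,q)=\inf\{L(\gamma): \gamma \text{ is a path joining } p \text{ and } q\}$ (with $\inf\emptyset=\infty$). Slices: for $x^*\in S_{X^*}$ and $\alpha>0$, the slice of $B_X$ determined by $x^*$ and $\alpha$ is $S(x^*,\alpha)=\{x\in B_X: x^*(x)>1-\alpha\}$. A convex combination of slices of $B_X$ is a set of the form $\sum_{i=1}^n\lambda_i S_i=\{\sum_{i=1}^n\lambda_i x_i: x_i\in S_i\}$ with $n\in\mathbb{N}$ ($n\ge 1$), $\lambda_i>0$, $\sum_{i=1}^n\lambda_i=1$, and $S_1,\dots,S_n$ slices of $B_X$. Properties of a Banach space $X$: - Daugavet property: for every $x\in S_X$, every slice $S$ of $B_X$ and every $\varepsilon>0$ there exists $y\in S$ with $\|x-y\|\ge 2-\varepsilon$. - LD2P (respectively D2P, SD2P): every slice of $B_X$ (respectively every nonempty relatively weakly open subset of $B_X$, every convex combination of slices of $B_X$) has diameter two. - ALD2P (respectively AD2P, ASD2P): the attaining versions, i.e. every slice of $B_X$ (respectively every nonempty relatively weakly open subset of $B_X$, every convex combination of slices of $B_X$) contains two points $x,y$ with $\|x-y\|=2$. *)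

theory Defs
  imports "HOL-Analysis.Analysis"
begin

section \<open>Length spaces\<close>

definition path_length :: "(real \<Rightarrow> 'a::metric_space) \<Rightarrow> ereal" where
  "path_length \<gamma> =
     Sup {ereal (\<Sum>i<n. dist (\<gamma> (t i)) (\<gamma> (t (Suc i)))) |n t.
            t 0 = (0::real) \<and> t n = 1 \<and> (\<forall>i<n. t i \<le> t (Suc i))}"

text \<open>The infimum is taken in the extended reals, so that it is \<open>\<infinity>\<close> when no path joins
  the two points.\<close>

definition length_space :: "'a::metric_space itself \<Rightarrow> bool" where
  "length_space _ \<longleftrightarrow>
     (\<forall>p q :: 'a. ereal (dist p q) =
        Inf {path_length \<gamma> |\<gamma>. path \<gamma> \<and> pathstart \<gamma> = p \<and> pathfinish \<gamma> = q})"


section \<open>Slices and diameter two properties of a Banach space\<close>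

text \<open>The dual of \<open>'x\<close> is the type \<open>'x \<Rightarrow>\<^sub>L real\<close> with the operator norm.\<close>

definition slice :: "('x::banach \<Rightarrow>\<^sub>L real) \<Rightarrow> real \<Rightarrow> 'x set" where
  "slice f \<alpha> = {x \<in> cball 0 1. blinfun_apply f x > 1 - \<alpha>}"

definition slices :: "'x::banach set set" where
  "slices = {slice f \<alpha> |f \<alpha>. norm f = 1 \<and> \<alpha> > 0}"

definition convex_combinations_of_slices :: "'x::banach set set" where
  "convex_combinations_of_slices =
     {{\<Sum>i<n. c i *\<^sub>R x i |x. \<forall>i<n. x i \<in> S i} |(n::nat) (c :: nat \<Rightarrow> real) (S :: nat \<Rightarrow> 'x set).
        n \<ge> 1 \<and> (\<forall>i<n. c i > 0) \<and> (\<Sum>i<n. c i) = 1 \<and> (\<forall>i<n. S i \<in> slices)}"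

definition weak_topology :: "'x::banach topology" where
  "weak_topology = topology_generated_by {blinfun_apply f -` U |(f :: 'x \<Rightarrow>\<^sub>L real) U. open U}"

definition relatively_weakly_open_sets :: "'x::banach set set" where
  "relatively_weakly_open_sets =
     {W. openin (subtopology weak_topology (cball 0 1)) W \<and> W \<noteq> {}}"

definition daugavet_property :: "'x::banach itself \<Rightarrow> bool" where
  "daugavet_property _ \<longleftrightarrow>
     (\<forall>x::'x. norm x = 1 \<longrightarrow>
        (\<forall>S\<in>slices. \<forall>\<epsilon>>0. \<exists>y\<in>S. norm (x - y) \<ge> 2 - \<epsilon>))"

definition LD2P :: "'x::banach itself \<Rightarrow> bool" where
  "LD2P _ \<longleftrightarrow> (\<forall>S\<in>(slices :: 'x set set). diameter S = 2)"

definition D2P :: "'x::banach itself \<Rightarrow> bool" where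
  "D2P _ \<longleftrightarrow> (\<forall>W\<in>(relatively_weakly_open_sets :: 'x set set). diameter W = 2)"

definition SD2P :: "'x::banach itself \<Rightarrow> bool" where
  "SD2P _ \<longleftrightarrow> (\<forall>C\<in>(convex_combinations_of_slices :: 'x set set). diameter C = 2)"

definition ALD2P :: "'x::banach itself \<Rightarrow> bool" where
  "ALD2P _ \<longleftrightarrow> (\<forall>S\<in>(slices :: 'x set set). \<exists>x\<in>S. \<exists>y\<in>S. norm (x - y) = 2)"

definition AD2P :: "'x::banach itself \<Rightarrow> bool" where
  "AD2P _ \<longleftrightarrow>
     (\<forall>W\<in>(relatively_weakly_open_sets :: 'x set set). \<exists>x\<in>W. \<exists>y\<in>W. norm (x - y) = 2)"

definition ASD2P :: "'x::banach itself \<Rightarrow> bool" where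
  "ASD2P _ \<longleftrightarrow>
     (\<forall>C\<in>(convex_combinations_of_slices :: 'x set set). \<exists>x\<in>C. \<exists>y\<in>C. norm (x - y) = 2)"


section \<open>Lipschitz functions vanishing at the distinguished point\<close>

text \<open>A pointed metric space is a type of class \<^class>\<open>metric_space\<close> that is also of the
  purely syntactic class \<^class>\<open>zero\<close>: its constant \<open>0\<close>, about which nothing is
  assumed, is the distinguished point.\<close>

typedef (overloaded) 'a lip0 =
  "{f :: 'a::{metric_space,zero} \<Rightarrow> real. f 0 = 0 \<and> (\<exists>C. C-lipschitz_on UNIV f)}"
  morphisms lip0_apply Lip0
  by (rule exI[of _ "\<lambda>_. 0"]) (auto intro: lipschitz_on_constant)

setup_lifting type_definition_lip0

lemma lip0_apply_zero [simp]: "lip0_apply f 0 = 0"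
  using lip0_apply[of f] by simp

lemma lip0_lipschitz: "\<exists>C. C-lipschitz_on UNIV (lip0_apply f)"
  using lip0_apply[of f] by simp

instantiation lip0 :: ("{metric_space,zero}") real_vector
begin

lift_definition zero_lip0 :: "'a lip0" is "\<lambda>_. 0"
  by (auto intro: lipschitz_on_constant)

lift_definition plus_lip0 :: "'a lip0 \<Rightarrow> 'a lip0 \<Rightarrow> 'a lip0" is "\<lambda>f g p. f p + g p"
  by (auto intro: lipschitz_on_add)

lift_definition minus_lip0 :: "'a lip0 \<Rightarrow> 'a lip0 \<Rightarrow> 'a lip0" is "\<lambda>f g p. f p - g p"
  by (auto intro: lipschitz_on_diff)

lift_definition uminus_lip0 :: "'a lip0 \<Rightarrow> 'a lip0" is "\<lambda>f p. - f p"
  by (auto intro: lipschitz_on_minus)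

lift_definition scaleR_lip0 :: "real \<Rightarrow> 'a lip0 \<Rightarrow> 'a lip0" is "\<lambda>c f p. c * f p"
  by (auto intro: lipschitz_on_cmult_real)

instance
  by standard (transfer; force simp: algebra_simps)+

end

text \<open>The pairs with \<open>p = q\<close> contribute \<open>0 / 0 = 0\<close> to the supremum. They make the
  set nonempty on a one-point space and are irrelevant otherwise, see \<open>norm_lip0_eq\<close> below.\<close>

instantiation lip0 :: ("{metric_space,zero}") real_normed_vector
begin

definition norm_lip0 :: "'a lip0 \<Rightarrow> real" where
  "norm_lip0 f = Sup {\<bar>lip0_apply f p - lip0_apply f q\<bar> / dist p q |p q. True}"

definition sgn_lip0 :: "'a lip0 \<Rightarrow> 'a lip0" where
  "sgn_lip0 f = f /\<^sub>R norm f"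

definition dist_lip0 :: "'a lip0 \<Rightarrow> 'a lip0 \<Rightarrow> real" where
  "dist_lip0 f g = norm (f - g)"

definition uniformity_lip0 :: "('a lip0 \<times> 'a lip0) filter" where
  "uniformity_lip0 = (INF e\<in>{0 <..}. principal {(f, g). dist f g < e})"

definition open_lip0 :: "'a lip0 set \<Rightarrow> bool" where
  "open_lip0 U \<longleftrightarrow> (\<forall>f\<in>U. \<forall>\<^sub>F (f', g) in uniformity. f' = f \<longrightarrow> g \<in> U)"

lemma lip0_bdd_above:
  "bdd_above {\<bar>lip0_apply f p - lip0_apply f q\<bar> / dist p q |p q. True}"
proof -
  obtain C where C: "C-lipschitz_on UNIV (lip0_apply f)"
    using lip0_lipschitz by blast
  have "\<bar>lip0_apply f p - lip0_apply f q\<bar> / dist p q \<le> C" for p q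
    using lipschitz_onD[OF C, of p q] lipschitz_on_nonneg[OF C]
    by (cases "p = q") (auto simp: dist_real_def divide_simps)
  then show ?thesis by (auto intro!: bdd_aboveI)
qed

lemma lip0_diff_le: "\<bar>lip0_apply f p - lip0_apply f q\<bar> \<le> norm f * dist p q"
proof -
  have "\<bar>lip0_apply f p - lip0_apply f q\<bar> / dist p q \<le> norm f"
    unfolding norm_lip0_def by (rule cSup_upper[OF _ lip0_bdd_above]) blast
  then show ?thesis by (cases "p = q") (auto simp: divide_simps)
qed

lemma norm_lip0_nonneg: "0 \<le> norm (f :: 'a lip0)"
proof -
  have "\<bar>lip0_apply f 0 - lip0_apply f 0\<bar> / dist (0::'a) 0 \<le> norm f"
    unfolding norm_lip0_def by (rule cSup_upper[OF _ lip0_bdd_above]) blast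
  then show ?thesis by simp
qed

lemma norm_lip0_le:
  assumes "0 \<le> C" "\<And>p q. \<bar>lip0_apply f p - lip0_apply f q\<bar> \<le> C * dist p q"
  shows "norm (f :: 'a lip0) \<le> C"
  unfolding norm_lip0_def
proof (rule cSup_least)
  fix x assume "x \<in> {\<bar>lip0_apply f p - lip0_apply f q\<bar> / dist p q |p q. True}"
  then obtain p q where "x = \<bar>lip0_apply f p - lip0_apply f q\<bar> / dist p q" by blast
  then show "x \<le> C"
    using assms(1) assms(2)[of p q] by (cases "p = q") (auto simp: pos_divide_le_eq)
qed blast

instance
proof
  fix f g :: "'a lip0" and c :: real
  show "norm f = 0 \<longleftrightarrow> f = 0"
  proof
    assume "norm f = 0"
    then have "lip0_apply f p = 0" for p
      using lip0_diff_le[of f p 0] by simp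
    then show "f = 0" by transfer auto
  next
    assume "f = 0"
    then have "lip0_apply f p = 0" for p by (simp add: zero_lip0.rep_eq)
    then have "norm f \<le> 0" by (intro norm_lip0_le) auto
    then show "norm f = 0" using norm_lip0_nonneg[of f] by simp
  qed
  show "norm (f + g) \<le> norm f + norm g"
  proof (rule norm_lip0_le)
    fix p q
    show "\<bar>lip0_apply (f + g) p - lip0_apply (f + g) q\<bar> \<le> (norm f + norm g) * dist p q"
      using lip0_diff_le[of f p q] lip0_diff_le[of g p q]
      by (simp add: plus_lip0.rep_eq distrib_right)
  qed (simp add: norm_lip0_nonneg)
  have le: "norm (c *\<^sub>R f) \<le> \<bar>c\<bar> * norm f" for c and f :: "'a lip0"
  proof (rule norm_lip0_le)
    fix p q
    have "\<bar>lip0_apply (c *\<^sub>R f) p - lip0_apply (c *\<^sub>R f) q\<bar>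
        = \<bar>c\<bar> * \<bar>lip0_apply f p - lip0_apply f q\<bar>"
      by (simp add: scaleR_lip0.rep_eq abs_mult flip: right_diff_distrib)
    then show "\<bar>lip0_apply (c *\<^sub>R f) p - lip0_apply (c *\<^sub>R f) q\<bar> \<le> \<bar>c\<bar> * norm f * dist p q"
      using mult_left_mono[OF lip0_diff_le[of f p q], of "\<bar>c\<bar>"] by (simp add: mult.assoc)
  qed (simp add: norm_lip0_nonneg)
  show "norm (c *\<^sub>R f) = \<bar>c\<bar> * norm f"
  proof (cases "c = 0")
    case True
    then show ?thesis using le[of c f] norm_lip0_nonneg[of "c *\<^sub>R f"] by simp
  next
    case False
    then have "norm f \<le> \<bar>inverse c\<bar> * norm (c *\<^sub>R f)"
      using le[of "inverse c" "c *\<^sub>R f"] by simp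
    then have "\<bar>c\<bar> * norm f \<le> norm (c *\<^sub>R f)"
      using False by (simp add: divide_simps abs_inverse mult.commute)
    then show ?thesis using le[of c f] by simp
  qed
qed (simp_all add: dist_lip0_def sgn_lip0_def uniformity_lip0_def open_lip0_def)

end

lemma norm_lip0_eq:
  fixes f :: "'a::{metric_space,zero} lip0"
  assumes "\<exists>p q :: 'a. p \<noteq> q"
  shows "norm f = Sup {\<bar>lip0_apply f p - lip0_apply f q\<bar> / dist p q |p q. p \<noteq> q}"
    (is "_ = Sup ?A")
proof (rule antisym)
  have bdd: "bdd_above ?A"
    by (rule bdd_above_mono[OF lip0_bdd_above[of f]]) blast
  have upper: "\<bar>lip0_apply f p - lip0_apply f q\<bar> / dist p q \<le> Sup ?A" if "p \<noteq> q" for p q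
    using that by (intro cSup_upper[OF _ bdd]) blast
  obtain a b :: 'a where "a \<noteq> b" using assms by blast
  then have "0 \<le> \<bar>lip0_apply f a - lip0_apply f b\<bar> / dist a b" by simp
  then have "0 \<le> Sup ?A" using upper[OF \<open>a \<noteq> b\<close>] by linarith
  then show "norm f \<le> Sup ?A"
  proof (rule norm_lip0_le)
    fix p q
    show "\<bar>lip0_apply f p - lip0_apply f q\<bar> \<le> Sup ?A * dist p q"
      using upper[of p q] by (cases "p = q") (auto simp: divide_simps)
  qed
  show "Sup ?A \<le> norm f"
    unfolding norm_lip0_def using assms by (intro cSup_subset_mono lip0_bdd_above) blast+
qed


section \<open>The Lipschitz-free space\<close>

lift_definition lip_delta :: "'a::{metric_space,zero} \<Rightarrow> 'a lip0 \<Rightarrow>\<^sub>L real"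
  is "\<lambda>p f. lip0_apply f p"
proof (rule bounded_linear_intro)
  fix p :: 'a and f g :: "'a lip0" and c :: real
  show "lip0_apply (f + g) p = lip0_apply f p + lip0_apply g p"
    by (simp add: plus_lip0.rep_eq)
  show "lip0_apply (c *\<^sub>R f) p = c *\<^sub>R lip0_apply f p"
    by (simp add: scaleR_lip0.rep_eq)
  show "norm (lip0_apply f p) \<le> norm f * dist p 0"
    using lip0_diff_le[of f p 0] by simp
qed

definition lipfree_set :: "('a::{metric_space,zero} lip0 \<Rightarrow>\<^sub>L real) set" where
  "lipfree_set = closure (span (range lip_delta))"

lemma subspace_lipfree_set: "subspace lipfree_set"
proof -
  have "subspace (closure V)" if V: "subspace V" for V :: "('a lip0 \<Rightarrow>\<^sub>L real) set"
  proof (rule subspaceI)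
    show "0 \<in> closure V"
      using subspace_0[OF V] closure_subset by blast
    show "x + y \<in> closure V" if xy: "x \<in> closure V" "y \<in> closure V" for x y
    proof -
      obtain X Y where "\<forall>n. X n \<in> V" "X \<longlonglongrightarrow> x" "\<forall>n. Y n \<in> V" "Y \<longlonglongrightarrow> y"
        using xy unfolding closure_sequential by blast
      then have "\<forall>n. X n + Y n \<in> V" "(\<lambda>n. X n + Y n) \<longlonglongrightarrow> x + y"
        by (simp_all add: subspace_add[OF V] tendsto_add)
      then show ?thesis unfolding closure_sequential by (intro exI[of _ "\<lambda>n. X n + Y n"]) simp
    qed
    show "c *\<^sub>R x \<in> closure V" if x: "x \<in> closure V" for c x
    proof -
      obtain X where "\<forall>n. X n \<in> V" "X \<longlonglongrightarrow> x"
        using x unfolding closure_sequential by blast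
      then have "\<forall>n. c *\<^sub>R X n \<in> V" "(\<lambda>n. c *\<^sub>R X n) \<longlonglongrightarrow> c *\<^sub>R x"
        by (simp_all add: subspace_scale[OF V] tendsto_scaleR)
      then show ?thesis unfolding closure_sequential by (intro exI[of _ "\<lambda>n. c *\<^sub>R X n"]) simp
    qed
  qed
  then show ?thesis by (simp add: lipfree_set_def)
qed

typedef (overloaded) 'a lipfree = "lipfree_set :: ('a::{metric_space,zero} lip0 \<Rightarrow>\<^sub>L real) set"
  morphisms lipfree_functional Lipfree
  using subspace_lipfree_set subspace_0 by blast

setup_lifting type_definition_lipfree

instantiation lipfree :: ("{metric_space,zero}") real_vector
begin

lift_definition zero_lipfree :: "'a lipfree" is 0
  by (rule subspace_0[OF subspace_lipfree_set])

lift_definition plus_lipfree :: "'a lipfree \<Rightarrow> 'a lipfree \<Rightarrow> 'a lipfree" is "(+)"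
  by (rule subspace_add[OF subspace_lipfree_set])

lift_definition minus_lipfree :: "'a lipfree \<Rightarrow> 'a lipfree \<Rightarrow> 'a lipfree" is "(-)"
  by (rule subspace_diff[OF subspace_lipfree_set])

lift_definition uminus_lipfree :: "'a lipfree \<Rightarrow> 'a lipfree" is uminus
  by (rule subspace_neg[OF subspace_lipfree_set])

lift_definition scaleR_lipfree :: "real \<Rightarrow> 'a lipfree \<Rightarrow> 'a lipfree" is "(*\<^sub>R)"
  by (rule subspace_scale[OF subspace_lipfree_set])

instance
  by standard (transfer; simp add: algebra_simps)+

end

instantiation lipfree :: ("{metric_space,zero}") real_normed_vector
begin

lift_definition norm_lipfree :: "'a lipfree \<Rightarrow> real" is norm .

definition sgn_lipfree :: "'a lipfree \<Rightarrow> 'a lipfree" where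
  "sgn_lipfree x = x /\<^sub>R norm x"

definition dist_lipfree :: "'a lipfree \<Rightarrow> 'a lipfree \<Rightarrow> real" where
  "dist_lipfree x y = norm (x - y)"

definition uniformity_lipfree :: "('a lipfree \<times> 'a lipfree) filter" where
  "uniformity_lipfree = (INF e\<in>{0 <..}. principal {(x, y). dist x y < e})"

definition open_lipfree :: "'a lipfree set \<Rightarrow> bool" where
  "open_lipfree U \<longleftrightarrow> (\<forall>x\<in>U. \<forall>\<^sub>F (x', y) in uniformity. x' = x \<longrightarrow> y \<in> U)"

instance
proof
  fix x y :: "'a lipfree" and a :: real
  show "norm x = 0 \<longleftrightarrow> x = 0" by transfer simp
  show "norm (x + y) \<le> norm x + norm y" by transfer (rule norm_triangle_ineq)
  show "norm (a *\<^sub>R x) = \<bar>a\<bar> * norm x" by transfer simp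
qed (simp_all add: dist_lipfree_def sgn_lipfree_def uniformity_lipfree_def open_lipfree_def)

end

lemma dist_lipfree_eq: "dist x y = dist (lipfree_functional x) (lipfree_functional y)"
  by (simp add: dist_norm norm_lipfree.rep_eq minus_lipfree.rep_eq)

instance lipfree :: ("{metric_space,zero}") banach
proof
  fix X :: "nat \<Rightarrow> 'a lipfree" assume "Cauchy X"
  then have "Cauchy (\<lambda>n. lipfree_functional (X n))"
    by (simp add: Cauchy_def dist_lipfree_eq)
  then obtain l where l: "(\<lambda>n. lipfree_functional (X n)) \<longlonglongrightarrow> l"
    by (auto simp: Cauchy_convergent_iff convergent_def)
  have "closed (lipfree_set :: ('a lip0 \<Rightarrow>\<^sub>L real) set)"
    by (simp add: lipfree_set_def)
  then have "l \<in> lipfree_set"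
    by (rule closed_sequentially[OF _ _ l]) (rule lipfree_functional)
  then have "X \<longlonglongrightarrow> Lipfree l"
    using l by (simp add: lim_sequentially dist_lipfree_eq Lipfree_inverse)
  then show "convergent X" by (auto simp: convergent_def)
qed

end

theory Submission
  imports Defs
begin

text \<open>
  Functionals on the Lipschitz-free space are Lipschitz functions: \<open>\<phi>\<close> corresponds to
  \<open>p \<mapsto> \<phi> (\<delta> p)\<close>, and since the span of the point masses \<open>\<delta> p\<close> is dense, the norm of \<open>\<phi>\<close> is the
  best Lipschitz constant of this function. Hence a slice given by \<open>\<phi>\<close> contains a molecule
  \<open>m\<^sub>u\<^sub>v = (\<delta> u - \<delta> v) / d(u, v)\<close> as soon as the function has a large slope between \<open>u\<close> and \<open>v\<close>,
  and lower bounds for norms are obtained by evaluating well chosen 1-Lipschitz functions.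

  From length spaces to Banach spaces. Along an almost shortest path a large slope has to occur at
  arbitrarily small scale, and it does so near infinitely many points
  (\<open>infinite_steep_points\<close>). A tiny molecule is invisible to a fixed finitely supported measure:
  a norming function can be flattened and given a small dip near the molecule, which yields
  the Daugavet property. For a convex combination of slices, tiny molecules are placed near distinct
  points; a single 1-Lipschitz function made of disjoint bumps then takes the value \<open>1\<close> on half of
  the molecules and \<open>-1\<close> on the other half, so the distance two is attained (ASD2P). The passage to
  relatively weakly open sets is Bourgain's lemma: each of them contains a convex combination of
  slices.

  From Banach spaces to length spaces. Every property in question implies LD2P. If some pair
  \<open>x \<noteq> y\<close> has quantitatively no points between \<open>x\<close> and \<open>y\<close>, there is a function with
  slope \<open>1\<close> at \<open>(x, y)\<close> whose slope drops linearly away from this pair; the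
  slices that it defines shrink to the molecule \<open>m\<^sub>x\<^sub>y\<close>, contradicting LD2P. So LD2P gives property
  (Z): between any two points there is an almost intermediate one. It remains to see that a complete
  space with (Z) is a length space. Fix a scale \<open>r\<close> and charge a chain of points twice its length on
  steps longer than \<open>r\<close>. Suppose that points at distance at most \<open>D\<close> are joined by chains of cost at most
  \<open>(1 + \<theta>)\<close> times their distance. Ekeland's principle, applied to the distance on
  pairs of points, together with (Z) shrinks any pair to one at distance at most \<open>r\<close> with almost no
  loss of length; the short pair costs exactly its distance, so \<open>\<theta>\<close> can be replaced by \<open>q \<theta>\<close> for a
  factor \<open>q < 1\<close> depending on \<open>r\<close> and \<open>D\<close> only (\<open>weighted_chain_improve\<close>). Iterating, chains with
  small steps have almost optimal length, hence approximate midpoints exist, and completeness turns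
  them into paths.
\<close>

section \<open>Implications between the diameter two properties\<close>

lemma diameter_eq_2I:
  fixes S :: "'x::real_normed_vector set"
  assumes sub: "S \<subseteq> cball 0 1"
    and far: "\<And>e. e > 0 \<Longrightarrow> \<exists>x\<in>S. \<exists>y\<in>S. norm (x - y) \<ge> 2 - e"
  shows "diameter S = 2"
proof (rule antisym)
  have "norm (x - y) \<le> 2" if "x \<in> S" "y \<in> S" for x y
    using norm_triangle_ineq4[of x y] subsetD[OF sub that(1)] subsetD[OF sub that(2)] by simp
  then show "diameter S \<le> 2" by (intro diameter_le) simp_all
  show "2 \<le> diameter S"
  proof (rule field_le_epsilon)
    fix e :: real assume "e > 0"
    then obtain x y where "x \<in> S" "y \<in> S" "norm (x - y) \<ge> 2 - e" using far by blast
    moreover have "bounded S" using sub bounded_cball bounded_subset by blast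
    ultimately show "2 \<le> diameter S + e"
      using diameter_bounded_bound[of S x y] by (simp add: dist_norm)
  qed
qed

lemma slice_subset_ball: "S \<in> slices \<Longrightarrow> S \<subseteq> cball 0 1"
  by (auto simp: slices_def slice_def)

lemma convex_combination_of_slices_subset_ball:
  assumes "C \<in> convex_combinations_of_slices"
  shows "C \<subseteq> cball 0 1"
proof
  fix y assume "y \<in> C"
  with assms obtain n c S x where c: "\<forall>i<n. c i > 0" "(\<Sum>i<n. c i) = (1::real)"
    and S: "\<forall>i<(n::nat). S i \<in> slices" and x: "\<forall>i<n. x i \<in> S i"
    and y: "y = (\<Sum>i<n. c i *\<^sub>R x i)"
    unfolding convex_combinations_of_slices_def by blast
  have "norm (x i) \<le> 1" if "i < n" for i
    using slice_subset_ball S x that by (meson mem_cball_0 subsetD)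
  then have "norm y \<le> (\<Sum>i<n. c i * 1)"
    unfolding y using c(1) by (intro sum_norm_le) (auto simp: mult_left_le)
  then show "y \<in> cball 0 1" using c by simp
qed

text \<open>A one-sided bound suffices because the unit ball is symmetric.\<close>

lemma norm_blinfun_le_of_ball:
  fixes f :: "'x::real_normed_vector \<Rightarrow>\<^sub>L real"
  assumes "\<And>x. norm x \<le> 1 \<Longrightarrow> f x \<le> c"
  shows "norm f \<le> c"
proof (rule norm_blinfun_bound)
  show "0 \<le> c" using assms[of 0] by simp
  show "norm (f x) \<le> c * norm x" for x
  proof (cases "x = 0")
    case False
    have "f (x /\<^sub>R norm x) \<le> c" "f (- (x /\<^sub>R norm x)) \<le> c"
      using False by (intro assms; simp)+
    then show ?thesis using False
      by (simp add: blinfun.scaleR_right blinfun.minus_right field_simps)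
  qed simp
qed

lemma slice_nonempty:
  assumes "S \<in> slices" shows "S \<noteq> {}"
proof
  assume "S = {}"
  with assms obtain f :: "'a \<Rightarrow>\<^sub>L real" and \<alpha> where f: "norm f = 1" "\<alpha> > 0" "slice f \<alpha> = {}"
    by (auto simp: slices_def)
  then have "f x \<le> 1 - \<alpha>" if "norm x \<le> 1" for x
    using that unfolding slice_def by force
  then have "norm f \<le> 1 - \<alpha>" by (rule norm_blinfun_le_of_ball)
  with f show False by simp
qed

lemma slice_imp_convex_combination:
  assumes "S \<in> slices" shows "S \<in> convex_combinations_of_slices"
proof -
  have "S = {\<Sum>i<(1::nat). (\<lambda>_. 1::real) i *\<^sub>R x i |x. \<forall>i<1. x i \<in> (\<lambda>_. S) i}"
    by (auto intro: exI[of _ "\<lambda>_. _"])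
  with assms show ?thesis unfolding convex_combinations_of_slices_def
    by (intro CollectI exI[of _ 1] exI[of _ "\<lambda>_. 1"] exI[of _ "\<lambda>_. S"]) simp
qed

lemma openin_weak_vimage:
  fixes f :: "'x::banach \<Rightarrow>\<^sub>L real"
  assumes "open U" shows "openin weak_topology (blinfun_apply f -` U)"
  unfolding weak_topology_def
  by (rule topology_generated_by_Basis, rule CollectI, rule exI[of _ f], rule exI[of _ U])
    (simp add: assms)

lemma slice_imp_relatively_weakly_open:
  assumes "S \<in> slices" shows "S \<in> relatively_weakly_open_sets"
proof -
  obtain f \<alpha> where "S = slice f \<alpha>" using assms by (auto simp: slices_def)
  then have "S = (blinfun_apply f -` {1 - \<alpha><..}) \<inter> cball 0 1" by (auto simp: slice_def)
  moreover have "openin weak_topology (blinfun_apply f -` {1 - \<alpha><..})"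
    by (rule openin_weak_vimage) simp
  ultimately have "openin (subtopology weak_topology (cball 0 1)) S"
    unfolding openin_subtopology by blast
  then show ?thesis
    using slice_nonempty[OF assms] by (simp add: relatively_weakly_open_sets_def)
qed

lemma relatively_weakly_open_subset_ball:
  "W \<in> relatively_weakly_open_sets \<Longrightarrow> W \<subseteq> cball 0 1"
  by (auto simp: relatively_weakly_open_sets_def openin_subtopology)

lemma diameter_eq_2_attainedI:
  fixes S :: "'x::real_normed_vector set"
  assumes "S \<subseteq> cball 0 1" and "\<exists>x\<in>S. \<exists>y\<in>S. norm (x - y) = 2"
  shows "diameter S = 2"
proof (rule diameter_eq_2I[OF assms(1)])
  fix e :: real assume "e > 0"
  obtain x y where "x \<in> S" "y \<in> S" "norm (x - y) = 2" using assms(2) by blast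
  with \<open>e > 0\<close> show "\<exists>x\<in>S. \<exists>y\<in>S. norm (x - y) \<ge> 2 - e"
    by (intro bexI[of _ x] bexI[of _ y]) auto
qed

lemma ASD2P_imp_SD2P: "ASD2P TYPE('x::banach) \<Longrightarrow> SD2P TYPE('x)"
  unfolding ASD2P_def SD2P_def
  by (intro ballI diameter_eq_2_attainedI convex_combination_of_slices_subset_ball) simp_all

lemma AD2P_imp_D2P: "AD2P TYPE('x::banach) \<Longrightarrow> D2P TYPE('x)"
  unfolding AD2P_def D2P_def
  by (intro ballI diameter_eq_2_attainedI relatively_weakly_open_subset_ball) simp_all

lemma ALD2P_imp_LD2P: "ALD2P TYPE('x::banach) \<Longrightarrow> LD2P TYPE('x)"
  unfolding ALD2P_def LD2P_def
  by (intro ballI diameter_eq_2_attainedI slice_subset_ball) simp_all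

lemma SD2P_imp_LD2P: "SD2P TYPE('x::banach) \<Longrightarrow> LD2P TYPE('x)"
  unfolding SD2P_def LD2P_def using slice_imp_convex_combination by blast

lemma D2P_imp_LD2P: "D2P TYPE('x::banach) \<Longrightarrow> LD2P TYPE('x)"
  unfolding D2P_def LD2P_def using slice_imp_relatively_weakly_open by blast

lemma ASD2P_imp_ALD2P: "ASD2P TYPE('x::banach) \<Longrightarrow> ALD2P TYPE('x)"
  unfolding ASD2P_def ALD2P_def using slice_imp_convex_combination by blast

text \<open>The Daugavet property is applied at a point of the slice itself, normalised to the sphere.
Normalising does not leave the slice when the functional is positive there, hence the width
\<open>min \<alpha> 1\<close> in the proof.\<close>

lemma daugavet_imp_LD2P:
  assumes "daugavet_property TYPE('x::banach)" shows "LD2P TYPE('x)"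
  unfolding LD2P_def
proof (intro ballI diameter_eq_2I slice_subset_ball)
  fix S :: "'x set" and e :: real assume S: "S \<in> slices" and "e > 0"
  then obtain f \<alpha> where f: "norm f = 1" "\<alpha> > 0" "S = slice f \<alpha>" by (auto simp: slices_def)
  have "slice f (min \<alpha> 1) \<noteq> {}" using f unfolding slices_def
    by (intro slice_nonempty[unfolded slices_def] CollectI exI[of _ f] exI[of _ "min \<alpha> 1"]) auto
  then obtain x where x: "norm x \<le> 1" "f x > 1 - \<alpha>" "f x > 0"
    by (auto simp: slice_def)
  define z where "z = x /\<^sub>R norm x"
  have "x \<noteq> 0" using x by auto
  then have "norm z = 1" "f z \<ge> f x"
    using x by (auto simp: z_def blinfun.scaleR_right field_simps)
  then have "z \<in> S" using x f by (simp add: slice_def)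
  moreover obtain y where "y \<in> S" "norm (z - y) \<ge> 2 - e"
    using assms \<open>norm z = 1\<close> S \<open>e > 0\<close> unfolding daugavet_property_def by blast
  ultimately show "\<exists>x\<in>S. \<exists>y\<in>S. norm (x - y) \<ge> 2 - e" by blast
qed

section \<open>Convex combinations of slices inside weakly open sets\<close>

text \<open>For a finite set \<open>F\<close> of functionals, \<open>gram F x y\<close> is the inner product of the images of \<open>x\<close> and \<open>y\<close>
under the map \<open>x \<mapsto> (f x)\<^sub>f\<^sub>\<in>\<^sub>F\<close> into a Euclidean space. It carries out Euclidean geometry for a set
\<open>F\<close> of arbitrary size on the space itself. Currying makes \<open>gram F a\<close> a functional, and those
functionals cut out the slices below.\<close>

definition gram :: "('x::real_normed_vector \<Rightarrow>\<^sub>L real) set \<Rightarrow> 'x \<Rightarrow> 'x \<Rightarrow>\<^sub>L real" where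
  "gram F a = (\<Sum>f\<in>F. blinfun_apply f a *\<^sub>R f)"

lemma gram_apply: "gram F a x = (\<Sum>f\<in>F. blinfun_apply f a * blinfun_apply f x)"
  by (simp add: gram_def blinfun.sum_left blinfun.scaleR_left)

lemma gram_commute: "gram F a x = gram F x a"
  by (simp add: gram_apply mult.commute)

lemma gram_linear_left:
  "gram F (a + b) x = gram F a x + gram F b x"
  "gram F (a - b) x = gram F a x - gram F b x"
  "gram F (c *\<^sub>R a) x = c * gram F a x"
  by (simp_all add: gram_apply blinfun.add_right blinfun.diff_right blinfun.scaleR_right
      algebra_simps sum.distrib sum_subtractf sum_distrib_left)

lemmas gram_linear = gram_linear_left blinfun.add_right blinfun.diff_right blinfun.scaleR_right

lemma gram_line:
  "gram F (a - s *\<^sub>R b) (a - s *\<^sub>R b) = gram F a a - 2 * s * gram F a b + s * s * gram F b b"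
  by (simp add: gram_linear gram_commute[of F b a] algebra_simps)

lemma gram_self_nonneg: "0 \<le> gram F x x"
  by (simp add: gram_apply sum_nonneg)

lemma square_le_gram: "finite F \<Longrightarrow> f \<in> F \<Longrightarrow> (blinfun_apply f x)\<^sup>2 \<le> gram F x x"
  unfolding gram_apply power2_eq_square
  by (rule member_le_sum[of f F "\<lambda>f. blinfun_apply f x * blinfun_apply f x"]) auto

lemma gram_self_le: "gram F x x \<le> (\<Sum>f\<in>F. (norm f)\<^sup>2) * (norm x)\<^sup>2"
proof -
  have "f x * f x \<le> (norm f)\<^sup>2 * (norm x)\<^sup>2" for f :: "'a \<Rightarrow>\<^sub>L real"
  proof -
    have "\<bar>f x\<bar>\<^sup>2 \<le> (norm f * norm x)\<^sup>2"
      using norm_blinfun[of f x] by (intro power_mono) auto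
    then show ?thesis by (simp add: power2_eq_square algebra_simps)
  qed
  then show ?thesis unfolding gram_apply sum_distrib_right by (intro sum_mono)
qed

text \<open>A point of a bounded set that is farthest from \<open>w\<close> in a Euclidean space is strongly exposed by the
direction away from \<open>w\<close>. Quantitatively: expanding squares, \<open>|x - x0|\<^sup>2\<close> is at most \<open>\<eta>\<close> plus twice
the amount by which \<open>\<phi> = \<langle>\<cdot>, x0 - w\<rangle>\<close> drops from \<open>x0\<close> to \<open>x\<close>, so a thin slice given by \<open>\<phi>\<close> is small.\<close>

lemma near_farthest_point_in_small_slice:
  fixes F :: "('x::banach \<Rightarrow>\<^sub>L real) set"
  assumes nontriv: "\<exists>f :: 'x \<Rightarrow>\<^sub>L real. norm f = 1" and "\<eta> > 0" and x0: "norm x0 \<le> 1"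
    and far: "\<And>x. norm x \<le> 1 \<Longrightarrow> gram F (x - w) (x - w) \<le> gram F (x0 - w) (x0 - w) + \<eta>"
  shows "\<exists>S\<in>slices. x0 \<in> S \<and> (\<forall>x\<in>S. gram F (x - x0) (x - x0) \<le> 3 * \<eta>)"
proof -
  define \<phi> where "\<phi> = gram F (x0 - w)"
  have key: "gram F (x - x0) (x - x0) \<le> \<eta> + 2 * (\<phi> x0 - \<phi> x)" if "norm x \<le> 1" for x
    using far[OF that] unfolding \<phi>_def
    by (simp add: gram_linear gram_commute[of F x x0] gram_commute[of F w x0] gram_commute[of F x w])
  have "\<phi> x \<le> \<phi> x0 + \<eta> / 2" if "norm x \<le> 1" for x
    using order_trans[OF gram_self_nonneg[of F "x - x0"] key[OF that]] by (simp add: field_simps)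
  then have norm_le: "norm \<phi> \<le> \<phi> x0 + \<eta> / 2" by (rule norm_blinfun_le_of_ball)
  have le_norm: "\<phi> x0 \<le> norm \<phi>"
  proof -
    have "\<phi> x0 \<le> norm \<phi> * norm x0" using norm_blinfun[of \<phi> x0] by simp
    also have "\<dots> \<le> norm \<phi>" using x0 by (simp add: mult_left_le)
    finally show ?thesis .
  qed
  show ?thesis
  proof (cases "\<phi> = 0")
    case True
    \<comment> \<open>For \<open>\<phi> = 0\<close> the whole ball is small, and a slice of width 3 is the whole ball.\<close>
    obtain f :: "'x \<Rightarrow>\<^sub>L real" where f: "norm f = 1" using nontriv by blast
    have "x0 \<in> slice f 3" using norm_blinfun[of f x0] x0 f by (auto simp: slice_def)
    moreover have "gram F (x - x0) (x - x0) \<le> 3 * \<eta>" if "x \<in> slice f 3" for x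
      using key[of x] that True \<open>\<eta> > 0\<close> by (simp add: slice_def)
    ultimately show ?thesis using f
      unfolding slices_def
      by (intro bexI[of _ "slice f 3"] CollectI exI[of _ f] exI[of _ 3]) auto
  next
    case False
    define S where "S = slice (\<phi> /\<^sub>R norm \<phi>) (\<eta> / norm \<phi>)"
    have S: "x \<in> S \<longleftrightarrow> norm x \<le> 1 \<and> norm \<phi> - \<eta> < \<phi> x" for x
    proof -
      have "1 - \<eta> / n < \<phi> x / n \<longleftrightarrow> n - \<eta> < \<phi> x" if "n > 0" for n
      proof -
        have "1 - \<eta> / n = (n - \<eta>) / n" using that by (simp add: diff_divide_distrib)
        then show ?thesis using that by (simp add: divide_less_cancel)
      qed
      from this[of "norm \<phi>"] show ?thesis
        using False by (simp add: S_def slice_def blinfun.scaleR_left divide_inverse mult.commute)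
    qed
    have "S \<in> slices" unfolding S_def slices_def using False \<open>\<eta> > 0\<close>
      by (intro CollectI exI[of _ "\<phi> /\<^sub>R norm \<phi>"] exI[of _ "\<eta> / norm \<phi>"]) simp
    moreover have "x0 \<in> S" using S x0 norm_le \<open>\<eta> > 0\<close> by simp
    moreover have "gram F (x - x0) (x - x0) \<le> 3 * \<eta>" if "x \<in> S" for x
      using key[of x] that S le_norm by fastforce
    ultimately show ?thesis by blast
  qed
qed

lemma farthest_small_slice:
  fixes F :: "('x::banach \<Rightarrow>\<^sub>L real) set" and w :: 'x
  assumes nontriv: "\<exists>f :: 'x \<Rightarrow>\<^sub>L real. norm f = 1" and "\<eta> > 0"
  shows "\<exists>x0. norm x0 \<le> 1 \<and>
      (\<forall>x. norm x \<le> 1 \<longrightarrow> gram F (x - w) (x - w) \<le> gram F (x0 - w) (x0 - w) + \<eta>) \<and>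
      (\<exists>S\<in>slices. x0 \<in> S \<and> (\<forall>x\<in>S. gram F (x - x0) (x - x0) \<le> 3 * \<eta>))"
proof -
  define V where "V = (\<lambda>x. gram F (x - w) (x - w)) ` cball 0 1"
  have "bdd_above V"
  proof (rule bdd_aboveI)
    fix v assume "v \<in> V"
    then obtain x where x: "norm x \<le> 1" "v = gram F (x - w) (x - w)" by (auto simp: V_def)
    have "norm (x - w) \<le> 1 + norm w" using norm_triangle_ineq4[of x w] x by linarith
    then have "(norm (x - w))\<^sup>2 \<le> (1 + norm w)\<^sup>2" by (intro power_mono) auto
    then show "v \<le> (\<Sum>f\<in>F. (norm f)\<^sup>2) * (1 + norm w)\<^sup>2"
      unfolding x using gram_self_le[of F "x - w"]
      by (meson mult_left_mono order_trans sum_nonneg zero_le_power2)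
  qed
  moreover have "V \<noteq> {}" by (auto simp: V_def)
  ultimately obtain v where v: "v \<in> V" "Sup V - \<eta> < v"
    using less_cSup_iff[of V "Sup V - \<eta>"] \<open>\<eta> > 0\<close> by auto
  then obtain x0 where x0: "norm x0 \<le> 1" "v = gram F (x0 - w) (x0 - w)" by (auto simp: V_def)
  have far: "gram F (x - w) (x - w) \<le> gram F (x0 - w) (x0 - w) + \<eta>" if "norm x \<le> 1" for x
  proof -
    have "gram F (x - w) (x - w) \<le> Sup V"
      using that \<open>bdd_above V\<close> by (intro cSup_upper) (auto simp: V_def)
    then show ?thesis using v x0 by linarith
  qed
  with near_farthest_point_in_small_slice[OF nontriv \<open>\<eta> > 0\<close> x0(1) far] x0 show ?thesis by blast
qed

text \<open>The points lying in small slices have convex hull dense in the ball, with respect to the seminorm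
of \<open>gram F\<close>. Otherwise project \<open>z\<close> onto the hull, approximately, to obtain \<open>c\<close>: the functional
given by \<open>a = z - c\<close> strictly separates \<open>z\<close> from the hull. But the points of the ball almost
farthest from a point \<open>- N a\<close> far away in the opposite direction lie in small slices
and nearly maximise \<open>\<langle>\<cdot>, a\<rangle>\<close> over the ball, a contradiction.\<close>

lemma convex_hull_of_small_slices_dense:
  fixes F :: "('x::banach \<Rightarrow>\<^sub>L real) set" and z :: 'x
  assumes nontriv: "\<exists>f :: 'x \<Rightarrow>\<^sub>L real. norm f = 1" and "\<eta> > 0" "\<tau> > 0" and z: "norm z \<le> 1"
  defines "G \<equiv> {x. \<exists>S\<in>slices. x \<in> S \<and> (\<forall>y\<in>S. gram F (y - x) (y - x) \<le> 3 * \<eta>)}"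
  shows "\<exists>c\<in>convex hull G. gram F (z - c) (z - c) < \<tau>"
proof (rule ccontr)
  assume "\<not> ?thesis"
  then have sep: "\<tau> \<le> gram F (z - c) (z - c)" if "c \<in> convex hull G" for c using that by force
  define C where "C = convex hull G"
  define V where "V = (\<lambda>c. gram F (z - c) (z - c)) ` C"
  define D where "D = Inf V"
  define R where "R = 4 * (\<Sum>f\<in>F. (norm f)\<^sup>2) + 1"
  have "R > 0" by (simp add: R_def add_nonneg_pos sum_nonneg)
  have G: "norm x \<le> 1" if "x \<in> G" for x
    using that slice_subset_ball unfolding G_def by fastforce
  have "C \<subseteq> cball 0 1" unfolding C_def using G by (intro hull_minimal) auto
  have R: "gram F (x - y) (x - y) \<le> R" if "norm x \<le> 1" "norm y \<le> 1" for x y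
  proof -
    have "norm (x - y) \<le> 2" using norm_triangle_ineq4[of x y] that by linarith
    then have "(norm (x - y))\<^sup>2 \<le> 2\<^sup>2" by (intro power_mono) auto
    then have "(\<Sum>f\<in>F. (norm f)\<^sup>2) * (norm (x - y))\<^sup>2 \<le> (\<Sum>f\<in>F. (norm f)\<^sup>2) * 2\<^sup>2"
      by (intro mult_left_mono) (auto intro: sum_nonneg)
    then show ?thesis using gram_self_le[of F "x - y"] by (simp add: R_def)
  qed
  obtain x1 where "x1 \<in> G"
    using farthest_small_slice[OF nontriv \<open>\<eta> > 0\<close>, of F 0] unfolding G_def by blast
  then have "V \<noteq> {}" unfolding V_def C_def using hull_inc by fastforce
  have bdd: "bdd_below V" unfolding V_def by (rule bdd_belowI2[of _ 0]) (simp add: gram_self_nonneg)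
  have "D \<ge> \<tau>" unfolding D_def using \<open>V \<noteq> {}\<close> sep by (intro cInf_greatest) (auto simp: V_def C_def)
  then have "D > 0" using \<open>\<tau> > 0\<close> by simp
  \<comment> \<open>The step \<open>s\<close> from \<open>c\<close> towards a competitor and the error \<open>s D / 4\<close> in the choice of \<open>c\<close> are
    balanced so that the first-order condition below loses only \<open>D / 4\<close>.\<close>
  define s where "s = min 1 (D / (4 * R))"
  have s: "0 < s" "s \<le> 1" "s * R \<le> D / 4"
    using \<open>D > 0\<close> \<open>R > 0\<close> by (auto simp: s_def min_def field_simps)
  have "Inf V < D + s * D / 4" using s \<open>D > 0\<close> by (simp add: D_def)
  then obtain c where c: "c \<in> C" "gram F (z - c) (z - c) < D + s * D / 4"
    using cInf_less_iff[OF \<open>V \<noteq> {}\<close> bdd] by (auto simp: V_def)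
  define a where "a = z - c"
  have aD: "D \<le> gram F a a" unfolding D_def a_def using c bdd by (intro cInf_lower) (auto simp: V_def)
  have C_le: "gram F a y \<le> gram F a z - 3 * D / 4" if y: "y \<in> C" for y
  proof -
    have "c + s *\<^sub>R (y - c) \<in> C"
      using convexD_alt[OF convex_convex_hull[of G], of c y s] c y s
      by (simp add: C_def algebra_simps)
    then have "D \<le> gram F (z - (c + s *\<^sub>R (y - c))) (z - (c + s *\<^sub>R (y - c)))"
      unfolding D_def using bdd by (intro cInf_lower) (auto simp: V_def)
    also have "z - (c + s *\<^sub>R (y - c)) = a - s *\<^sub>R (y - c)" by (simp add: a_def)
    also have "gram F \<dots> \<dots> = gram F a a - 2 * s * gram F a (y - c) + s * s * gram F (y - c) (y - c)"
      by (rule gram_line)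
    also have "s * s * gram F (y - c) (y - c) \<le> s * s * R"
      using R \<open>C \<subseteq> cball 0 1\<close> y c by (intro mult_left_mono) (auto simp: subset_iff)
    also have "s * s * R \<le> s * (D / 4)" using s by (simp add: mult.assoc)
    finally have "D \<le> gram F a a - 2 * s * gram F a (y - c) + s * (D / 4)" by simp
    moreover have "gram F a a < D + s * (D / 4)" using c(2) by (simp add: a_def)
    ultimately have "s * (2 * gram F a (y - c)) \<le> s * (D / 2)" by (simp add: algebra_simps)
    then have "2 * gram F a (y - c) \<le> D / 2" using s(1) mult_le_cancel_left_pos by blast
    moreover have "gram F a z - gram F a c = gram F a a"
      unfolding a_def[symmetric] blinfun.diff_right[symmetric] ..
    ultimately show ?thesis using aD unfolding blinfun.diff_right by (simp add: field_simps)
  qed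
  \<comment> \<open>Dividing the farthest point inequality by \<open>2 N\<close>, the terms other than \<open>\<langle>\<cdot>, a\<rangle>\<close> contribute at most
    \<open>D / 2\<close>, less than the gap \<open>3 D / 4\<close> of the separation.\<close>
  define N where "N = (R + \<eta>) / D"
  have "N > 0" using \<open>R > 0\<close> \<open>D > 0\<close> \<open>\<eta> > 0\<close> by (simp add: N_def)
  obtain x0 where x0: "norm x0 \<le> 1" "x0 \<in> G"
    and far: "\<And>x. norm x \<le> 1 \<Longrightarrow>
      gram F (x - (- N *\<^sub>R a)) (x - (- N *\<^sub>R a)) \<le> gram F (x0 - (- N *\<^sub>R a)) (x0 - (- N *\<^sub>R a)) + \<eta>"
    using farthest_small_slice[OF nontriv \<open>\<eta> > 0\<close>, of F "- N *\<^sub>R a"] unfolding G_def by blast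
  have "gram F z z + 2 * N * gram F a z \<le> gram F x0 x0 + 2 * N * gram F a x0 + \<eta>"
    using far[OF z] by (simp add: gram_linear gram_commute[of F x0 a] gram_commute[of F z a] algebra_simps)
  moreover have "gram F x0 x0 \<le> R" using R[of x0 0] x0 by simp
  moreover have "gram F a x0 \<le> gram F a z - 3 * D / 4" using x0 by (intro C_le) (simp add: C_def hull_inc)
  ultimately have "2 * N * gram F a z \<le> R + 2 * N * (gram F a z - 3 * D / 4) + \<eta>"
    using gram_self_nonneg[of F z] \<open>N > 0\<close> mult_left_mono[of "gram F a x0" "gram F a z - 3 * D / 4" "2 * N"]
    by linarith
  then have "N * D * 3 / 2 \<le> R + \<eta>" by (simp add: algebra_simps)
  also have "R + \<eta> = N * D" using \<open>D > 0\<close> by (simp add: N_def)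
  finally show False using \<open>N > 0\<close> \<open>D > 0\<close> mult_pos_pos[of N D] by linarith
qed

lemma weak_open_contains_basic:
  fixes U :: "'x::banach set"
  assumes "openin weak_topology U" "x \<in> U"
  shows "\<exists>(F :: ('x \<Rightarrow>\<^sub>L real) set) (e :: real). finite F \<and> e > 0 \<and> {y. \<forall>f\<in>F. \<bar>blinfun_apply f (y - x)\<bar> < e} \<subseteq> U"
proof -
  have "generate_topology_on {blinfun_apply f -` U |(f :: 'x \<Rightarrow>\<^sub>L real) U. open U} U"
    using assms(1) unfolding weak_topology_def openin_topology_generated_by_iff .
  then show ?thesis using \<open>x \<in> U\<close>
  proof (induction arbitrary: x)
    case (Int a b)
    obtain F :: "('x \<Rightarrow>\<^sub>L real) set" and e :: real where F: "finite F" "e > 0" "{y. \<forall>f\<in>F. \<bar>blinfun_apply f (y - x)\<bar> < e} \<subseteq> a"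
      using Int.IH(1)[of x] Int.prems by blast
    obtain F' :: "('x \<Rightarrow>\<^sub>L real) set" and e' :: real where F': "finite F'" "e' > 0" "{y. \<forall>f\<in>F'. \<bar>blinfun_apply f (y - x)\<bar> < e'} \<subseteq> b"
      using Int.IH(2)[of x] Int.prems by blast
    have "{y. \<forall>f\<in>F \<union> F'. \<bar>blinfun_apply f (y - x)\<bar> < min e e'} \<subseteq> a \<inter> b"
      using F(3) F'(3) by (simp add: subset_iff)
    with F F' show ?case by (intro exI[of _ "F \<union> F'"] exI[of _ "min e e'"]) simp
  next
    case (UN K)
    then obtain k where k: "k \<in> K" "x \<in> k" by blast
    then show ?case using UN.IH[OF k] by blast
  next
    case (Basis s)
    then obtain f :: "'x \<Rightarrow>\<^sub>L real" and V where s: "s = blinfun_apply f -` V" "open V" by blast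
    then obtain e where "e > 0" "ball (f x) e \<subseteq> V" using Basis by (meson openE vimageE)
    then show ?case unfolding s
      by (intro exI[of _ "{f}"] exI[of _ e])
         (auto simp: blinfun.diff_right dist_real_def abs_minus_commute subset_iff)
  qed simp
qed

text \<open>Bourgain's lemma. Choose a basic weak neighbourhood of \<open>z\<close>, approximate \<open>z\<close> by a convex combination
of points in slices that are small for the finitely many functionals involved, and let each point
vary in its slice.\<close>

lemma weak_open_contains_convex_combination:
  fixes W :: "'x::banach set"
  assumes nontriv: "\<exists>f :: 'x \<Rightarrow>\<^sub>L real. norm f = 1" and W: "W \<in> relatively_weakly_open_sets"
  shows "\<exists>C\<in>convex_combinations_of_slices. C \<subseteq> W"
proof -
  obtain U where U: "openin weak_topology U" "W = U \<inter> cball 0 1" "W \<noteq> {}"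
    using W by (auto simp: relatively_weakly_open_sets_def openin_subtopology)
  then obtain z where z: "z \<in> U" "norm z \<le> 1" by auto
  obtain F :: "('x \<Rightarrow>\<^sub>L real) set" and e :: real where F: "finite F" "e > 0" "{y. \<forall>f\<in>F. \<bar>blinfun_apply f (y - z)\<bar> < e} \<subseteq> U"
    using weak_open_contains_basic[OF U(1) z(1)] by blast
  have "(e / 2)\<^sup>2 / 3 > 0" "(e / 2)\<^sup>2 > 0" using F by auto
  then obtain c where c: "gram F (z - c) (z - c) < (e / 2)\<^sup>2"
    "c \<in> convex hull {x. \<exists>S\<in>slices. x \<in> S \<and> (\<forall>y\<in>S. gram F (y - x) (y - x) \<le> 3 * ((e / 2)\<^sup>2 / 3))}"
    using convex_hull_of_small_slices_dense[OF nontriv _ _ z(2), of "(e / 2)\<^sup>2 / 3" "(e / 2)\<^sup>2" F] by blast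
  then obtain T u where T: "finite T" and
    TS: "\<And>x. x \<in> T \<Longrightarrow> \<exists>S\<in>slices. x \<in> S \<and> (\<forall>y\<in>S. gram F (y - x) (y - x) \<le> (e / 2)\<^sup>2)"
    and u: "\<forall>x\<in>T. 0 \<le> u x" "sum u T = 1" "(\<Sum>x\<in>T. u x *\<^sub>R x) = c"
    unfolding convex_hull_explicit by (auto simp: subset_iff)
  define P where "P = {x\<in>T. u x > 0}"
  have P: "finite P" "sum u P = 1" "(\<Sum>x\<in>P. u x *\<^sub>R x) = c"
    using T u unfolding P_def
    by (auto simp: sum.inter_filter intro!: sum.cong trans[OF _ u(2)] trans[OF _ u(3)])
  obtain Sl where Sl: "\<And>x. x \<in> P \<Longrightarrow> Sl x \<in> slices \<and> x \<in> Sl x \<and>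
      (\<forall>y\<in>Sl x. gram F (y - x) (y - x) \<le> (e / 2)\<^sup>2)"
    using TS unfolding P_def by (metis (no_types, lifting) mem_Collect_eq)
  obtain n where "n = card P" by simp
  obtain b where b: "bij_betw b {..<n} P"
    using ex_bij_betw_nat_finite[OF P(1)] \<open>n = card P\<close> by (auto simp: atLeast0LessThan)
  have bP: "b i \<in> P" if "i < n" for i using b that by (auto simp: bij_betw_def)
  have sum_b: "(\<Sum>i<n. u (b i)) = 1" "(\<Sum>i<n. u (b i) *\<^sub>R b i) = c"
    using sum.reindex_bij_betw[OF b, of u] sum.reindex_bij_betw[OF b, of "\<lambda>x. u x *\<^sub>R x"] P by auto
  have upos: "u (b i) > 0" if "i < n" for i using bP[OF that] by (simp add: P_def)
  have "n \<ge> 1" using sum_b(1) by (cases n) auto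
  define C where "C = {\<Sum>i<n. (u \<circ> b) i *\<^sub>R x i |x. \<forall>i<n. x i \<in> (Sl \<circ> b) i}"
  have CC: "C \<in> convex_combinations_of_slices"
    unfolding convex_combinations_of_slices_def C_def
    using \<open>n \<ge> 1\<close> sum_b Sl bP upos
    by (intro CollectI exI[of _ n] exI[of _ "u \<circ> b"] exI[of _ "Sl \<circ> b"]) auto
  have "C \<subseteq> W"
  proof
    fix y assume "y \<in> C"
    then obtain x where x: "\<And>i. i < n \<Longrightarrow> x i \<in> Sl (b i)" "y = (\<Sum>i<n. u (b i) *\<^sub>R x i)"
      by (auto simp: C_def)
    have "norm y \<le> 1" using convex_combination_of_slices_subset_ball[OF CC] \<open>y \<in> C\<close> by auto
    moreover have "\<bar>f (y - z)\<bar> < e" if f: "f \<in> F" for f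
    proof -
      have le: "\<bar>f v\<bar> \<le> e / 2" if "gram F v v \<le> (e / 2)\<^sup>2" for v
      proof (rule power2_le_imp_le)
        have "(f v)\<^sup>2 \<le> (e / 2)\<^sup>2" using square_le_gram[OF F(1) f, of v] that by (rule order_trans)
        then show "\<bar>f v\<bar>\<^sup>2 \<le> (e / 2)\<^sup>2" by (subst power2_abs)
      qed (use F(2) in simp)
      have "y - c = (\<Sum>i<n. u (b i) *\<^sub>R (x i - b i))"
        using sum_b by (simp add: x scaleR_right_diff_distrib sum_subtractf)
      then have "\<bar>f (y - c)\<bar> \<le> (\<Sum>i<n. \<bar>u (b i) * f (x i - b i)\<bar>)"
        by (simp add: blinfun.sum_right blinfun.scaleR_right)
      also have "\<dots> \<le> (\<Sum>i<n. u (b i) * (e / 2))"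
        unfolding abs_mult using upos Sl bP x le
        by (intro sum_mono mult_mono) (auto simp: less_imp_le)
      also have "\<dots> = e / 2" using sum_b(1) sum_distrib_right[of "\<lambda>i. u (b i)" "{..<n}" "e / 2"] by simp
      finally have "\<bar>f (y - c)\<bar> \<le> e / 2" .
      moreover have "\<bar>f (z - c)\<bar> < e / 2"
      proof (rule power2_less_imp_less)
        have "(f (z - c))\<^sup>2 < (e / 2)\<^sup>2"
          using square_le_gram[OF F(1) f, of "z - c"] c(1) by (rule order_le_less_trans)
        then show "\<bar>f (z - c)\<bar>\<^sup>2 < (e / 2)\<^sup>2" by (subst power2_abs)
        show "0 \<le> e / 2" using F(2) by simp
      qed
      ultimately show ?thesis unfolding blinfun.diff_right by linarith
    qed
    ultimately show "y \<in> W" using F(3) U by auto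
  qed
  with CC show ?thesis by blast
qed

text \<open>On the zero space there are no slices and ASD2P holds vacuously while AD2P fails; the first
assumption excludes this case.\<close>

lemma ASD2P_imp_AD2P:
  assumes "\<exists>f :: 'x::banach \<Rightarrow>\<^sub>L real. norm f = 1" "ASD2P TYPE('x)"
  shows "AD2P TYPE('x)"
  unfolding AD2P_def
proof
  fix W :: "'x set" assume "W \<in> relatively_weakly_open_sets"
  then obtain C where "C \<in> convex_combinations_of_slices" "C \<subseteq> W"
    using weak_open_contains_convex_combination[OF assms(1)] by blast
  then show "\<exists>x\<in>W. \<exists>y\<in>W. norm (x - y) = 2"
    using assms(2) unfolding ASD2P_def by blast
qed

section \<open>Paths and slopes of functions on length spaces\<close>

lemma dist_le_path_length: "ereal (dist (\<gamma> 0) (\<gamma> 1)) \<le> path_length \<gamma>"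
  unfolding path_length_def
  by (rule Sup_upper, rule CollectI, rule exI[of _ 1], rule exI[of _ "\<lambda>i. if i = 0 then 0 else 1"]) simp

lemma sum_dist_le_path_length:
  assumes "t 0 = 0" "t n = 1" "\<And>i. i < n \<Longrightarrow> t i \<le> t (Suc i)"
  shows "ereal (\<Sum>i<n. dist (\<gamma> (t i)) (\<gamma> (t (Suc i)))) \<le> path_length \<gamma>"
  unfolding path_length_def
  by (rule Sup_upper, rule CollectI, rule exI[of _ n], rule exI[of _ t]) (simp add: assms)

lemma path_length_le_of_lipschitz:
  assumes "\<And>s t. s \<in> {0..1} \<Longrightarrow> t \<in> {0..1} \<Longrightarrow> dist (\<gamma> s) (\<gamma> t) \<le> C * \<bar>s - t\<bar>"
  shows "path_length \<gamma> \<le> ereal C"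
  unfolding path_length_def
proof (rule Sup_least)
  fix l assume "l \<in> {ereal (\<Sum>i<n. dist (\<gamma> (t i)) (\<gamma> (t (Suc i)))) |n t.
            t 0 = (0::real) \<and> t n = 1 \<and> (\<forall>i<n. t i \<le> t (Suc i))}"
  then obtain n t where l: "l = ereal (\<Sum>i<n. dist (\<gamma> (t i)) (\<gamma> (t (Suc i))))"
    and t: "t 0 = 0" "t n = (1::real)" "\<And>i. i < n \<Longrightarrow> t i \<le> t (Suc i)" by blast
  have mono: "t i \<le> t j" if "i \<le> j" "j \<le> n" for i j
    using that by (induction j rule: dec_induct) (auto intro: order_trans[OF _ t(3)])
  have t01: "t i \<in> {0..1}" if "i \<le> n" for i
    using mono[of 0 i] mono[of i n] that t by simp
  have "(\<Sum>i<n. dist (\<gamma> (t i)) (\<gamma> (t (Suc i)))) \<le> (\<Sum>i<n. C * (t (Suc i) - t i))"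
  proof (rule sum_mono)
    fix i assume "i \<in> {..<n}"
    then show "dist (\<gamma> (t i)) (\<gamma> (t (Suc i))) \<le> C * (t (Suc i) - t i)"
      using assms[OF t01[of i] t01[of "Suc i"]] t(3)[of i] by (simp add: abs_minus_commute)
  qed
  also have "\<dots> = C" using t by (simp flip: sum_distrib_left add: sum_lessThan_telescope)
  finally show "l \<le> ereal C" by (simp add: l)
qed

lemma length_spaceI:
  assumes "\<And>(p::'a::metric_space) q e. e > 0 \<Longrightarrow>
    \<exists>\<gamma>. path \<gamma> \<and> pathstart \<gamma> = p \<and> pathfinish \<gamma> = q \<and> path_length \<gamma> \<le> ereal (dist p q + e)"
  shows "length_space TYPE('a)"
  unfolding length_space_def
proof (intro allI antisym)
  fix p q :: 'a
  let ?L = "{path_length \<gamma> |\<gamma>. path \<gamma> \<and> pathstart \<gamma> = p \<and> pathfinish \<gamma> = q}"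
  show "ereal (dist p q) \<le> Inf ?L"
    by (rule Inf_greatest) (use dist_le_path_length in \<open>force simp: pathstart_def pathfinish_def\<close>)
  show "Inf ?L \<le> ereal (dist p q)"
  proof (rule ereal_le_epsilon2)
    fix e :: real assume "e > 0"
    then obtain \<gamma> where "path \<gamma>" "pathstart \<gamma> = p" "pathfinish \<gamma> = q"
      "path_length \<gamma> \<le> ereal (dist p q + e)" using assms by blast
    then show "Inf ?L \<le> ereal (dist p q) + ereal e"
      by (intro Inf_lower2[of "path_length \<gamma>"]) auto
  qed
qed

lemma length_space_short_path:
  fixes p q :: "'a::metric_space"
  assumes "length_space TYPE('a)" "e > 0"
  obtains \<gamma> where "path \<gamma>" "pathstart \<gamma> = p" "pathfinish \<gamma> = q" "path_length \<gamma> < ereal (dist p q + e)"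
proof -
  have "Inf {path_length \<gamma> |\<gamma>. path \<gamma> \<and> pathstart \<gamma> = p \<and> pathfinish \<gamma> = q} < ereal (dist p q + e)"
    using assms unfolding length_space_def by (metis ereal_less(2) ereal_less_eq(3) less_add_same_cancel1 less_ereal.simps(1))
  then show ?thesis using that unfolding Inf_less_iff by blast
qed

lemma path_fine_partition:
  assumes "path \<gamma>" "\<delta> > 0"
  obtains n :: nat where "n > 0" "\<And>i. i < n \<Longrightarrow> dist (\<gamma> (real i / n)) (\<gamma> (real (Suc i) / n)) < \<delta>"
proof -
  have "uniformly_continuous_on {0..1} \<gamma>"
    using assms(1) unfolding path_def by (intro compact_uniformly_continuous) auto
  then obtain \<eta> where \<eta>: "\<eta> > 0" "\<And>s t. s \<in> {0..1} \<Longrightarrow> t \<in> {0..1} \<Longrightarrow> dist s t < \<eta> \<Longrightarrow> dist (\<gamma> s) (\<gamma> t) < \<delta>"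
    using \<open>\<delta> > 0\<close> unfolding uniformly_continuous_on_def by metis
  obtain n where n: "inverse (real (Suc n)) < \<eta>" using reals_Archimedean[OF \<open>\<eta> > 0\<close>] by blast
  show ?thesis
  proof (rule that[of "Suc n"])
    fix i assume i: "i < Suc n"
    have eq: "dist (real i / Suc n) (real (Suc i) / Suc n) = inverse (real (Suc n))"
      by (simp add: dist_real_def inverse_eq_divide flip: diff_divide_distrib)
    show "dist (\<gamma> (real i / Suc n)) (\<gamma> (real (Suc i) / Suc n)) < \<delta>"
    proof (rule \<eta>(2))
      show "dist (real i / Suc n) (real (Suc i) / Suc n) < \<eta>" unfolding eq by (rule n)
    qed (use i in \<open>auto simp: divide_simps\<close>)
  qed simp
qed

text \<open>Adding up the local estimate over a fine partition of a path bounds the increment of \<open>f\<close> by \<open>c\<close> times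
the length of the path.\<close>

lemma length_space_locally_lipschitz:
  fixes f :: "'a::metric_space \<Rightarrow> real"
  assumes len: "length_space TYPE('a)" and c: "0 \<le> c"
    and loc: "\<And>s. \<exists>e>0. \<forall>u\<in>ball s e. \<forall>v\<in>ball s e. f u - f v \<le> c * dist u v"
  shows "f p - f q \<le> c * dist p q"
proof (rule field_le_epsilon)
  fix e :: real assume "e > 0"
  then have "e / (c + 1) > 0" using c by simp
  then obtain \<gamma> where \<gamma>: "path \<gamma>" "pathstart \<gamma> = p" "pathfinish \<gamma> = q"
    "path_length \<gamma> < ereal (dist p q + e / (c + 1))"
    using length_space_short_path[OF len] by metis
  define B where "B = {ball s e |s e. e > 0 \<and> (\<forall>u\<in>ball s e. \<forall>v\<in>ball s e. f u - f v \<le> c * dist u v)}"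
  have "s \<in> \<Union>B" for s
  proof -
    obtain e where "e > 0" "\<forall>u\<in>ball s e. \<forall>v\<in>ball s e. f u - f v \<le> c * dist u v" using loc by blast
    then show ?thesis unfolding B_def by (intro UnionI[of "ball s e"]) auto
  qed
  then have "path_image \<gamma> \<subseteq> \<Union>B" by blast
  moreover have "compact (path_image \<gamma>)" using \<gamma>(1) by (rule compact_path_image)
  moreover have "B \<noteq> {}" using \<open>\<And>s. s \<in> \<Union>B\<close> by blast
  moreover have "\<And>b. b \<in> B \<Longrightarrow> open b" by (auto simp: B_def)
  ultimately obtain \<delta> where \<delta>: "\<delta> > 0"
    "\<And>T. T \<subseteq> path_image \<gamma> \<Longrightarrow> diameter T < \<delta> \<Longrightarrow> \<exists>b\<in>B. T \<subseteq> b"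
    using Lebesgue_number_lemma[of "path_image \<gamma>" B] by metis
  have step: "f u - f v \<le> c * dist u v"
    if uv: "u \<in> path_image \<gamma>" "v \<in> path_image \<gamma>" "dist u v < \<delta>" for u v
  proof -
    have "diameter {u, v} \<le> dist u v"
      unfolding diameter_def by (auto intro!: cSup_least simp: dist_commute)
    then obtain b where "b \<in> B" "{u, v} \<subseteq> b" using \<delta>(2)[of "{u, v}"] uv by auto
    then show ?thesis unfolding B_def by blast
  qed
  obtain n :: nat where n: "n > 0" "\<And>i. i < n \<Longrightarrow> dist (\<gamma> (real i / n)) (\<gamma> (real (Suc i) / n)) < \<delta>"
    using path_fine_partition[OF \<gamma>(1) \<delta>(1)] by metis
  define t where "t i = real i / n" for i
  have t: "t 0 = 0" "t n = 1" using n by (auto simp: t_def)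
  have im: "\<gamma> (t i) \<in> path_image \<gamma>" if "i \<le> n" for i
    using that n(1) by (auto simp: path_image_def t_def divide_simps)
  have "f p - f q = (\<Sum>i<n. f (\<gamma> (t i)) - f (\<gamma> (t (Suc i))))"
    using t \<gamma>(2,3) sum_lessThan_telescope'[of "\<lambda>i. f (\<gamma> (t i))" n]
    by (simp add: pathstart_def pathfinish_def)
  also have "\<dots> \<le> (\<Sum>i<n. c * dist (\<gamma> (t i)) (\<gamma> (t (Suc i))))"
  proof (intro sum_mono step)
    fix i assume i: "i \<in> {..<n}"
    then show "\<gamma> (t i) \<in> path_image \<gamma>" "\<gamma> (t (Suc i)) \<in> path_image \<gamma>" by (auto intro!: im)
    show "dist (\<gamma> (t i)) (\<gamma> (t (Suc i))) < \<delta>" using n(2)[of i] i by (simp add: t_def)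
  qed
  also have "\<dots> = c * (\<Sum>i<n. dist (\<gamma> (t i)) (\<gamma> (t (Suc i))))" by (rule sum_distrib_left[symmetric])
  also have "\<dots> \<le> c * (dist p q + e / (c + 1))"
  proof (rule mult_left_mono[OF _ c])
    have "ereal (\<Sum>i<n. dist (\<gamma> (t i)) (\<gamma> (t (Suc i)))) \<le> path_length \<gamma>"
      using t n(1) by (intro sum_dist_le_path_length) (auto simp: t_def divide_simps)
    also note \<gamma>(4)
    finally show "(\<Sum>i<n. dist (\<gamma> (t i)) (\<gamma> (t (Suc i)))) \<le> dist p q + e / (c + 1)" by simp
  qed
  also have "\<dots> \<le> c * dist p q + e"
  proof -
    have "c * (e / (c + 1)) \<le> (c + 1) * (e / (c + 1))"
      using c \<open>e > 0\<close> by (intro mult_right_mono) auto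
    also have "\<dots> = e" using c by simp
    finally show ?thesis by (simp add: distrib_left)
  qed
  finally show "f p - f q \<le> c * dist p q + e" .
qed

text \<open>Slopes exceeding \<open>c\<close> occur in every neighbourhood of \<open>s\<close>; the strict inequality forces \<open>u \<noteq> v\<close>.\<close>

definition steep_at :: "('a::metric_space \<Rightarrow> real) \<Rightarrow> real \<Rightarrow> 'a \<Rightarrow> bool" where
  "steep_at f c s \<longleftrightarrow> (\<forall>e>0. \<exists>u\<in>ball s e. \<exists>v\<in>ball s e. f u - f v > c * dist u v)"

text \<open>The 1-Lipschitz monotone function that vanishes on \<open>[- \<eta>, \<eta>]\<close> and is a translation on each side.\<close>

definition soft_threshold :: "real \<Rightarrow> real \<Rightarrow> real" where
  "soft_threshold \<eta> x = x - max (- \<eta>) (min \<eta> x)"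

text \<open>Finitely many steep points can be ignored. Soft thresholding around the value at one of them makes
the function constant near that point, creates no new steep points, and changes the function
by at most \<open>\<eta>\<close>; so the exceptional points are removed one at a time.\<close>

lemma lipschitz_off_finite_set:
  fixes f :: "'a::metric_space \<Rightarrow> real"
  assumes len: "length_space TYPE('a)" and c: "0 \<le> c" and "finite F"
    and "continuous_on UNIV f" "{s. steep_at f c s} \<subseteq> F"
  shows "f p - f q \<le> c * dist p q"
  using assms(3-)
proof (induction F arbitrary: f p q rule: finite_induct)
  case empty
  then have "\<not> steep_at f c s" for s by blast
  then have "\<exists>e>0. \<forall>u\<in>ball s e. \<forall>v\<in>ball s e. f u - f v \<le> c * dist u v" for s
    unfolding steep_at_def by (simp add: not_less)
  then show ?case by (rule length_space_locally_lipschitz[OF len c])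
next
  case (insert a F)
  have "f p - f q \<le> c * dist p q + e" if "e > 0" for e
  proof -
    define \<eta> where "\<eta> = e / 2"
    have "\<eta> > 0" using that by (simp add: \<eta>_def)
    define g where "g x = soft_threshold \<eta> (f x - f a)" for x
    have cont: "continuous_on UNIV g"
      unfolding g_def soft_threshold_def by (intro continuous_intros insert.prems)
    have g_pos: "g u - g v \<le> f u - f v" if "g u > g v" for u v
      using that \<open>\<eta> > 0\<close> unfolding g_def soft_threshold_def by (simp add: max_def min_def split: if_splits)
    have g_close: "f u - f v \<le> g u - g v + 2 * \<eta>" for u v
      using \<open>\<eta> > 0\<close> unfolding g_def soft_threshold_def by (simp add: max_def min_def)
    have steep: "steep_at f c s" if "steep_at g c s" for s
      unfolding steep_at_def
    proof (intro allI impI)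
      fix e :: real assume "e > 0"
      then obtain u v where uv: "u \<in> ball s e" "v \<in> ball s e" "g u - g v > c * dist u v"
        using \<open>steep_at g c s\<close> unfolding steep_at_def by blast
      have "0 \<le> c * dist u v" using c by simp
      then have "f u - f v > c * dist u v" using g_pos[of v u] uv(3) by linarith
      with uv show "\<exists>u\<in>ball s e. \<exists>v\<in>ball s e. f u - f v > c * dist u v" by blast
    qed
    have "\<not> steep_at g c a"
    proof -
      have "isCont f a" using insert.prems(1) continuous_on_eq_continuous_at open_UNIV by blast
      then obtain d where "d > 0" and d: "\<And>x. dist x a < d \<Longrightarrow> \<bar>f x - f a\<bar> < \<eta>"
        using \<open>\<eta> > 0\<close> unfolding continuous_at_eps_delta dist_real_def by blast
      have "g x = 0" if "x \<in> ball a d" for x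
      proof -
        have "\<bar>f x - f a\<bar> < \<eta>" using d that by (simp add: dist_commute)
        then show ?thesis unfolding g_def soft_threshold_def by (simp add: max_def min_def abs_less_iff)
      qed
      then have "\<not> (g u - g v > c * dist u v)" if "u \<in> ball a d" "v \<in> ball a d" for u v
        using that c by (simp add: not_less)
      with \<open>d > 0\<close> show ?thesis unfolding steep_at_def by blast
    qed
    then have "{s. steep_at g c s} \<subseteq> F" using steep insert.prems(2) by blast
    then have "g p - g q \<le> c * dist p q" using insert.IH cont by blast
    then show ?thesis using g_close[of p q] by (simp add: \<eta>_def)
  qed
  then show ?case by (rule field_le_epsilon)
qed

lemma infinite_steep_points:
  fixes f :: "'a::metric_space \<Rightarrow> real"
  assumes "length_space TYPE('a)" "0 \<le> c" "continuous_on UNIV f" "f p - f q > c * dist p q"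
  shows "infinite {s. steep_at f c s}"
proof
  assume "finite {s. steep_at f c s}"
  then have "f p - f q \<le> c * dist p q" using lipschitz_off_finite_set assms by blast
  with assms(4) show False by simp
qed

section \<open>Functionals and molecules on the Lipschitz-free space\<close>

lift_definition point_mass :: "'a::{metric_space,zero} \<Rightarrow> 'a lipfree" is lip_delta
  unfolding lipfree_set_def by (intro subsetD[OF closure_subset] span_base rangeI)

lemma bounded_linear_lipfree_eval:
  "bounded_linear (\<lambda>\<mu>. blinfun_apply (lipfree_functional \<mu>) f)"
proof (rule bounded_linear_intro)
  show "norm (blinfun_apply (lipfree_functional \<mu>) f) \<le> norm \<mu> * norm f" for \<mu>
    unfolding norm_lipfree.rep_eq by (rule norm_blinfun)
qed (simp_all add: plus_lipfree.rep_eq scaleR_lipfree.rep_eq blinfun.add_left blinfun.scaleR_left)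

text \<open>The canonical action of Lipschitz functions; by \<open>functional_of_lipschitz\<close> and \<open>functional_eqI\<close>
every functional is of this form.\<close>

definition pairing :: "'a::{metric_space,zero} lip0 \<Rightarrow> 'a lipfree \<Rightarrow>\<^sub>L real" where
  "pairing f = Blinfun (\<lambda>\<mu>. blinfun_apply (lipfree_functional \<mu>) f)"

lemma pairing_apply: "pairing f \<mu> = blinfun_apply (lipfree_functional \<mu>) f"
  unfolding pairing_def by (simp add: bounded_linear_Blinfun_apply bounded_linear_lipfree_eval)

lemma pairing_point_mass: "pairing f (point_mass p) = lip0_apply f p"
  by (simp add: pairing_apply point_mass.rep_eq lip_delta.rep_eq)

lemma norm_pairing_le: "norm (pairing f) \<le> norm f"
proof (rule norm_blinfun_bound)
  show "norm (pairing f \<mu>) \<le> norm f * norm \<mu>" for \<mu>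
    using norm_blinfun[of "lipfree_functional \<mu>" f]
    by (simp add: pairing_apply norm_lipfree.rep_eq mult.commute)
qed simp

lemma point_mass_zero [simp]: "point_mass 0 = 0"
  by transfer (rule blinfun_eqI, simp add: lip_delta.rep_eq)

lemma norm_point_mass_diff_le: "norm (point_mass p - point_mass q) \<le> dist p q"
proof -
  have "norm (lip_delta p - lip_delta q) \<le> dist p q"
    by (rule norm_blinfun_bound)
       (use lip0_diff_le in \<open>auto simp: blinfun.diff_left lip_delta.rep_eq mult.commute\<close>)
  then show ?thesis by (simp add: norm_lipfree.rep_eq minus_lipfree.rep_eq point_mass.rep_eq)
qed

lemma functional_point_mass_diff_le:
  fixes \<phi> :: "'a::{metric_space,zero} lipfree \<Rightarrow>\<^sub>L real"
  shows "\<bar>\<phi> (point_mass p) - \<phi> (point_mass q)\<bar> \<le> norm \<phi> * dist p q"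
proof -
  have "\<bar>\<phi> (point_mass p - point_mass q)\<bar> \<le> norm \<phi> * norm (point_mass p - point_mass q)"
    using norm_blinfun[of \<phi> "point_mass p - point_mass q"] by simp
  also have "\<dots> \<le> norm \<phi> * dist p q" by (intro mult_left_mono norm_point_mass_diff_le) simp
  finally show ?thesis by (simp add: blinfun.diff_right)
qed

lemma functional_lipschitz:
  fixes \<phi> :: "'a::{metric_space,zero} lipfree \<Rightarrow>\<^sub>L real"
  assumes "norm \<phi> \<le> 1"
  shows "\<phi> (point_mass p) - \<phi> (point_mass q) \<le> dist p q"
proof -
  have "\<bar>\<phi> (point_mass p) - \<phi> (point_mass q)\<bar> \<le> norm \<phi> * dist p q" by (rule functional_point_mass_diff_le)
  also have "\<dots> \<le> dist p q" using assms by (simp add: mult_left_le_one_le)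
  finally show ?thesis by simp
qed

text \<open>The space is a type copy of the closed span of the evaluations in the dual of the space of
Lipschitz functions; the density of the span is transported to the copy.\<close>

lemma closure_span_point_masses:
  "closure (span (range point_mass)) = (UNIV :: 'a::{metric_space,zero} lipfree set)"
proof -
  have "linear (lipfree_functional :: 'a lipfree \<Rightarrow> _)"
    by (rule linearI) (simp_all add: plus_lipfree.rep_eq scaleR_lipfree.rep_eq)
  then have span: "span (range lip_delta) = lipfree_functional ` span (range (point_mass :: 'a \<Rightarrow> _))"
    by (simp add: linear_span_image[symmetric] image_image point_mass.rep_eq)
  have "\<mu> \<in> closure (span (range point_mass))" for \<mu> :: "'a lipfree"
    unfolding closure_approachable
  proof (intro allI impI)
    fix e :: real assume "e > 0"
    have "lipfree_functional \<mu> \<in> closure (span (range lip_delta))"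
      using lipfree_functional[of \<mu>] by (simp add: lipfree_set_def)
    then show "\<exists>\<nu>\<in>span (range point_mass). dist \<nu> \<mu> < e"
      using \<open>e > 0\<close> unfolding closure_approachable span dist_lipfree_eq by blast
  qed
  then show ?thesis by blast
qed

lemma functional_eqI:
  fixes \<phi> \<psi> :: "'a::{metric_space,zero} lipfree \<Rightarrow>\<^sub>L real"
  assumes "\<And>p. \<phi> (point_mass p) = \<psi> (point_mass p)"
  shows "\<phi> = \<psi>"
proof (rule blinfun_eqI)
  fix \<mu> :: "'a lipfree"
  have "closed {\<mu>. \<phi> \<mu> = \<psi> \<mu>}" by (intro closed_Collect_eq continuous_intros)
  moreover have "subspace {\<mu>. \<phi> \<mu> = \<psi> \<mu>}"
    by (rule subspaceI) (auto simp: blinfun.add_right blinfun.scaleR_right)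
  then have "span (range point_mass) \<subseteq> {\<mu>. \<phi> \<mu> = \<psi> \<mu>}"
    using assms by (intro span_minimal) auto
  ultimately have "closure (span (range point_mass)) \<subseteq> {\<mu>. \<phi> \<mu> = \<psi> \<mu>}"
    by (intro closure_minimal)
  then show "\<phi> \<mu> = \<psi> \<mu>" unfolding closure_span_point_masses by blast
qed

text \<open>The function is normalised by \<open>h 0\<close> because the point mass at the distinguished point is zero.\<close>

lemma functional_of_lipschitz:
  fixes h :: "'a::{metric_space,zero} \<Rightarrow> real"
  assumes "0 \<le> c" "\<And>p q. h p - h q \<le> c * dist p q"
  obtains \<phi> :: "'a lipfree \<Rightarrow>\<^sub>L real" where "norm \<phi> \<le> c" "\<And>p. blinfun_apply \<phi> (point_mass p) = h p - h 0"
proof -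
  have abs: "\<bar>h p - h q\<bar> \<le> c * dist p q" for p q
    using assms(2)[of p q] assms(2)[of q p] by (simp add: abs_le_iff dist_commute)
  define f where "f = Lip0 (\<lambda>p. h p - h 0)"
  have f: "lip0_apply f = (\<lambda>p. h p - h 0)"
    unfolding f_def
    by (rule Lip0_inverse) (use assms(1) abs in \<open>auto simp: dist_real_def intro!: exI[of _ c] lipschitz_onI\<close>)
  have "norm f \<le> c" by (rule norm_lip0_le) (use assms(1) abs f in auto)
  then show ?thesis
    using that[of "pairing f"] norm_pairing_le[of f] f by (simp add: pairing_point_mass)
qed

text \<open>The norm of a functional is the best Lipschitz constant of its restriction to the point masses:
that restriction generates, through the pairing, a functional of norm at most \<open>c\<close>, which agrees
with \<open>\<phi>\<close> by density.\<close>

lemma norm_functional_le: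
  fixes \<phi> :: "'a::{metric_space,zero} lipfree \<Rightarrow>\<^sub>L real"
  assumes "0 \<le> c" "\<And>p q. \<phi> (point_mass p) - \<phi> (point_mass q) \<le> c * dist p q"
  shows "norm \<phi> \<le> c"
proof -
  obtain \<psi> where \<psi>: "norm \<psi> \<le> c" "\<And>p. blinfun_apply \<psi> (point_mass p) = \<phi> (point_mass p) - \<phi> (point_mass 0)"
    using functional_of_lipschitz[of c "\<lambda>p. \<phi> (point_mass p)"] assms by blast
  then have "\<psi> = \<phi>" by (intro functional_eqI) (simp add: blinfun.zero_right)
  with \<psi> show ?thesis by simp
qed

text \<open>The space is normed by the Lipschitz functions, by definition of its norm as an operator norm.\<close>

lemma norm_lipfree_le:
  fixes \<mu> :: "'a::{metric_space,zero} lipfree"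
  assumes "\<And>\<phi> :: 'a lipfree \<Rightarrow>\<^sub>L real. norm \<phi> \<le> 1 \<Longrightarrow> blinfun_apply \<phi> \<mu> \<le> c"
  shows "norm \<mu> \<le> c"
  unfolding norm_lipfree.rep_eq
proof (rule norm_blinfun_le_of_ball)
  fix f :: "'a lip0" assume "norm f \<le> 1"
  then have "norm (pairing f) \<le> 1" using norm_pairing_le[of f] by simp
  then show "blinfun_apply (lipfree_functional \<mu>) f \<le> c"
    using assms[of "pairing f"] by (simp add: pairing_apply)
qed

lemma functional_le_norm:
  fixes \<phi> :: "'x::real_normed_vector \<Rightarrow>\<^sub>L real"
  assumes "norm \<phi> \<le> 1" shows "\<phi> \<mu> \<le> norm \<mu>"
proof -
  have "\<phi> \<mu> \<le> norm \<phi> * norm \<mu>" using norm_blinfun[of \<phi> \<mu>] by simp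
  also have "\<dots> \<le> norm \<mu>" using assms by (simp add: mult_left_le_one_le)
  finally show ?thesis .
qed

text \<open>For \<open>p = q\<close> this is \<open>0\<close>.\<close>

definition molecule :: "'a::{metric_space,zero} \<Rightarrow> 'a \<Rightarrow> 'a lipfree" where
  "molecule p q = (point_mass p - point_mass q) /\<^sub>R dist p q"

lemma norm_molecule_le: "norm (molecule p q) \<le> 1"
  using norm_point_mass_diff_le[of p q] by (cases "p = q") (simp_all add: molecule_def inverse_eq_divide pos_divide_le_eq)

lemma functional_molecule:
  "blinfun_apply \<phi> (molecule p q) = (blinfun_apply \<phi> (point_mass p) - blinfun_apply \<phi> (point_mass q)) / dist p q"
  by (simp add: molecule_def blinfun.scaleR_right blinfun.diff_right divide_inverse mult.commute)

lemma exists_norm_one_functional: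
  assumes "(x::'a::{metric_space,zero}) \<noteq> y"
  shows "\<exists>\<phi> :: 'a lipfree \<Rightarrow>\<^sub>L real. norm \<phi> = 1"
proof -
  obtain \<phi> where \<phi>: "norm \<phi> \<le> 1" "\<And>p. blinfun_apply \<phi> (point_mass p) = dist p y - dist 0 y"
    using functional_of_lipschitz[of 1 "\<lambda>p. dist p y"] by (auto simp: dist_triangle diff_le_eq)
  have "1 \<le> norm \<phi>"
    using functional_point_mass_diff_le[of \<phi> x y] assms by (simp add: \<phi> field_simps)
  with \<phi>(1) show ?thesis by (intro exI[of _ \<phi>]) simp
qed

text \<open>On the unit ball of the dual, uniform closeness of the Lipschitz functions controls the values at
\<open>\<mu>\<close>: for a finite combination of point masses this is clear, and such combinations are dense.\<close>

lemma pointwise_close_functionals: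
  fixes \<mu> :: "'a::{metric_space,zero} lipfree" and e :: real
  assumes "e > 0"
  obtains \<eta> where "\<eta> > 0" "\<And>\<phi> \<psi> :: 'a lipfree \<Rightarrow>\<^sub>L real. norm \<phi> \<le> 1 \<Longrightarrow> norm \<psi> \<le> 1 \<Longrightarrow>
    (\<And>p. \<bar>blinfun_apply \<phi> (point_mass p) - blinfun_apply \<psi> (point_mass p)\<bar> \<le> \<eta>) \<Longrightarrow>
    \<bar>blinfun_apply \<phi> \<mu> - blinfun_apply \<psi> \<mu>\<bar> \<le> e"
proof -
  have "e / 4 > 0" using assms by simp
  moreover have "\<mu> \<in> closure (span (range point_mass))" by (simp add: closure_span_point_masses)
  ultimately obtain \<nu> where \<nu>: "\<nu> \<in> span (range point_mass)" "norm (\<nu> - \<mu>) < e / 4"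
    unfolding closure_approachable dist_norm by blast
  have "\<exists>K\<ge>0. \<forall>\<phi> :: 'a lipfree \<Rightarrow>\<^sub>L real. \<forall>\<eta>. (\<forall>p. \<bar>\<phi> (point_mass p)\<bar> \<le> \<eta>) \<longrightarrow> \<bar>\<phi> \<nu>\<bar> \<le> K * \<eta>"
    using \<nu>(1)
  proof (induction rule: span_induct_alt)
    case base
    then show ?case by (intro exI[of _ 0]) (simp add: blinfun.zero_right)
  next
    case (step c x y)
    then obtain K p where K: "K \<ge> 0" "\<And>(\<phi> :: 'a lipfree \<Rightarrow>\<^sub>L real) \<eta>. (\<forall>p. \<bar>\<phi> (point_mass p)\<bar> \<le> \<eta>) \<Longrightarrow> \<bar>\<phi> y\<bar> \<le> K * \<eta>"
      and p: "x = point_mass p" by blast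
    have "\<bar>\<phi> (c *\<^sub>R x + y)\<bar> \<le> (\<bar>c\<bar> + K) * \<eta>"
      if \<phi>: "\<forall>p. \<bar>\<phi> (point_mass p)\<bar> \<le> \<eta>" for \<phi> :: "'a lipfree \<Rightarrow>\<^sub>L real" and \<eta>
    proof -
      have "\<bar>\<phi> (c *\<^sub>R x + y)\<bar> \<le> \<bar>c * \<phi> x\<bar> + \<bar>\<phi> y\<bar>"
        by (simp add: blinfun.add_right blinfun.scaleR_right abs_triangle_ineq)
      also have "\<bar>c * \<phi> x\<bar> \<le> \<bar>c\<bar> * \<eta>" unfolding abs_mult p using \<phi> by (intro mult_left_mono) auto
      finally show ?thesis using K(2)[OF \<phi>] by (simp add: distrib_right)
    qed
    then show ?case using K(1) by (intro exI[of _ "\<bar>c\<bar> + K"]) simp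
  qed
  then obtain K where K: "K \<ge> 0" "\<And>(\<phi> :: 'a lipfree \<Rightarrow>\<^sub>L real) \<eta>. (\<And>p. \<bar>\<phi> (point_mass p)\<bar> \<le> \<eta>) \<Longrightarrow> \<bar>\<phi> \<nu>\<bar> \<le> K * \<eta>"
    by blast
  define \<eta> where "\<eta> = e / (2 * (K + 1))"
  have \<eta>: "\<eta> > 0" "K * \<eta> \<le> e / 2" using K(1) assms by (auto simp: \<eta>_def field_simps)
  show ?thesis
  proof (rule that[OF \<eta>(1)])
    fix \<phi> \<psi> :: "'a lipfree \<Rightarrow>\<^sub>L real"
    assume n: "norm \<phi> \<le> 1" "norm \<psi> \<le> 1" and close: "\<And>p. \<bar>\<phi> (point_mass p) - \<psi> (point_mass p)\<bar> \<le> \<eta>"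
    have "\<bar>(\<phi> - \<psi>) \<nu>\<bar> \<le> K * \<eta>" using close by (intro K) (simp add: blinfun.diff_left)
    moreover have "\<bar>(\<phi> - \<psi>) (\<nu> - \<mu>)\<bar> \<le> 2 * (e / 4)"
    proof -
      have "\<bar>(\<phi> - \<psi>) (\<nu> - \<mu>)\<bar> \<le> norm (\<phi> - \<psi>) * norm (\<nu> - \<mu>)"
        using norm_blinfun[of "\<phi> - \<psi>" "\<nu> - \<mu>"] by simp
      also have "\<dots> \<le> 2 * (e / 4)"
        using norm_triangle_ineq4[of \<phi> \<psi>] n \<nu>(2) by (intro mult_mono) auto
      finally show ?thesis .
    qed
    ultimately have "\<bar>(\<phi> - \<psi>) \<mu>\<bar> \<le> e" using \<eta>(2) unfolding blinfun.diff_right by linarith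
    then show "\<bar>\<phi> \<mu> - \<psi> \<mu>\<bar> \<le> e" by (simp add: blinfun.diff_left)
  qed
qed

section \<open>Length spaces have the Daugavet and the attaining strong diameter two property\<close>

text \<open>Near \<open>s\<close> the thresholded function vanishes, so there is room for a bump at \<open>v\<close> that
makes the slope between \<open>u\<close> and \<open>v\<close> equal to \<open>-1\<close>. The sum remains 1-Lipschitz: where the
thresholded part is nonzero it is smaller by \<open>\<eta>\<close> than the distance to \<open>s\<close>, which pays for the
bump. At the same time the function moves only slightly.\<close>

lemma flat_with_dip:
  fixes g :: "'a::metric_space \<Rightarrow> real"
  assumes g: "\<And>p q. g p - g q \<le> dist p q" and "\<eta> > 0"
    and u: "u \<in> ball s (\<eta> / 4)" and v: "v \<in> ball s (\<eta> / 4)"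
  defines "h \<equiv> \<lambda>p. soft_threshold \<eta> (g p - g s) + max 0 (dist u v - dist p v)"
  shows "h p - h q \<le> dist p q" "h u - h v = - dist u v" "\<bar>h p - (g p - g s)\<bar> \<le> 2 * \<eta>"
proof -
  define T where "T p = soft_threshold \<eta> (g p - g s)" for p
  define b where "b p = max 0 (dist u v - dist p v)" for p
  have h: "h p = T p + b p" for p by (simp add: h_def T_def b_def)
  have sv: "dist s v < \<eta> / 4" "dist s u < \<eta> / 4" using u v by auto
  have uv: "dist u v < \<eta> / 2" using sv dist_triangle3[of u v s] by simp
  have T_lip: "T p - T q \<le> dist p q" for p q
    using g[of p q] \<open>\<eta> > 0\<close> zero_le_dist[of p q]
    by (auto simp: T_def soft_threshold_def max_def min_def simp del: zero_le_dist)
  have b_lip: "b p - b q \<le> dist p q" for p q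
    using dist_triangle3[of q v p] zero_le_dist[of p q] by (auto simp: b_def max_def simp del: zero_le_dist)
  have T_le: "\<bar>T p\<bar> \<le> max 0 (dist p s - \<eta>)" for p
    using g[of p s] g[of s p] \<open>\<eta> > 0\<close> dist_commute[of s p]
    by (auto simp: T_def soft_threshold_def max_def min_def abs_if)
  have T0: "T p = 0" if "dist p s \<le> \<eta>" for p using T_le[of p] that by (simp add: max_def split: if_splits)
  have b_pos: "T p = 0 \<and> b p = dist u v - dist p v \<and> dist p s < dist p v + \<eta> / 4" if "b p > 0" for p
  proof -
    have "dist p v < dist u v" "b p = dist u v - dist p v" using that by (auto simp: b_def max_def split: if_splits)
    moreover have "dist p s < dist p v + \<eta> / 4" using dist_triangle[of p s v] sv by (simp add: dist_commute)
    ultimately show ?thesis using uv \<open>\<eta> > 0\<close> by (auto intro!: T0)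
  qed
  have b_nonneg: "b p \<ge> 0" for p by (simp add: b_def)
  show "h p - h q \<le> dist p q"
  proof (cases "b p > 0")
    case p: True
    show ?thesis
    proof (cases "b q > 0")
      case True
      then show ?thesis using b_pos[OF p] b_pos[OF True] b_lip[of p q] by (simp add: h)
    next
      case False
      then have bq: "b q = 0" using b_nonneg[of q] by simp
      show ?thesis
      proof (cases "T q \<ge> 0")
        case True
        then show ?thesis using b_pos[OF p] b_lip[of p q] bq by (simp add: h)
      next
        case False
        then have "- T q \<le> dist q s - \<eta>" using T_le[of q] by (auto simp: max_def split: if_splits)
        moreover have "dist q s \<le> dist p q + dist p s" using dist_triangle[of q s p] by (simp add: dist_commute)
        ultimately show ?thesis using b_pos[OF p] uv bq \<open>\<eta> > 0\<close> by (simp add: h)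
      qed
    qed
  next
    case False
    then have bp: "b p = 0" using b_nonneg[of p] by simp
    show ?thesis using T_lip[of p q] b_nonneg[of q] bp by (simp add: h)
  qed
  have "T u = 0" "T v = 0" using sv \<open>\<eta> > 0\<close> by (auto intro!: T0 simp: dist_commute)
  then show "h u - h v = - dist u v" by (simp add: h b_def)
  have "\<bar>T p - (g p - g s)\<bar> \<le> \<eta>" using \<open>\<eta> > 0\<close> by (auto simp: T_def soft_threshold_def max_def min_def abs_if)
  moreover have "b p \<le> \<eta> / 2" using uv \<open>\<eta> > 0\<close> zero_le_dist[of p v] by (auto simp: b_def max_def simp del: zero_le_dist)
  ultimately show "\<bar>h p - (g p - g s)\<bar> \<le> 2 * \<eta>" using b_nonneg[of p] \<open>\<eta> > 0\<close> by (simp add: h)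
qed

text \<open>By \<open>norm_functional_le\<close>, slopes above \<open>c\<close> occur at all; on a length space they then occur at
infinitely many places.\<close>

lemma infinite_steep_points_functional:
  fixes \<phi> :: "'a::{metric_space,zero} lipfree \<Rightarrow>\<^sub>L real"
  assumes "length_space TYPE('a)" "0 \<le> c" "c < norm \<phi>"
  shows "infinite {s. steep_at (\<lambda>p. \<phi> (point_mass p)) c s}"
proof -
  define f where "f p = \<phi> (point_mass p)" for p
  have "\<exists>p q. f p - f q > c * dist p q"
  proof (rule ccontr)
    assume "\<nexists>p q. f p - f q > c * dist p q"
    then have "norm \<phi> \<le> c" unfolding f_def by (intro norm_functional_le assms(2)) (simp add: not_less)
    with assms(3) show False by simp
  qed
  then obtain p q where "f p - f q > c * dist p q" by blast
  moreover have "(norm \<phi>)-lipschitz_on UNIV f"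
    using functional_point_mass_diff_le[of \<phi>] by (intro lipschitz_onI) (auto simp: f_def dist_real_def)
  then have "continuous_on UNIV f" by (rule lipschitz_on_continuous_on)
  ultimately show ?thesis using infinite_steep_points[OF assms(1,2)] unfolding f_def by blast
qed

lemma molecule_in_slice:
  fixes \<phi> :: "'a::{metric_space,zero} lipfree \<Rightarrow>\<^sub>L real"
  assumes "0 \<le> c" "1 - \<alpha> \<le> c" "\<phi> (point_mass u) - \<phi> (point_mass v) > c * dist u v"
  shows "molecule u v \<in> slice \<phi> \<alpha>" "u \<noteq> v"
proof -
  show "u \<noteq> v" using assms(3) by auto
  then have "c < \<phi> (molecule u v)" using assms(3) by (simp add: functional_molecule less_divide_eq)
  then show "molecule u v \<in> slice \<phi> \<alpha>" using assms(2) norm_molecule_le by (simp add: slice_def)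
qed

text \<open>Take a functional \<open>\<psi>\<close> almost norming \<open>\<mu>\<close> and a tiny molecule in the slice. Giving \<open>\<psi>\<close> a dip along
the molecule barely changes its value at \<open>\<mu>\<close>, while the value at the molecule becomes \<open>-1\<close>.\<close>

theorem length_space_imp_daugavet:
  assumes len: "length_space TYPE('a::{metric_space,zero})"
  shows "daugavet_property TYPE('a lipfree)"
  unfolding daugavet_property_def
proof (intro allI impI ballI)
  fix \<mu> :: "'a lipfree" and S :: "'a lipfree set" and e :: real
  assume \<mu>: "norm \<mu> = 1" and S: "S \<in> slices" and "e > 0"
  obtain \<phi> :: "'a lipfree \<Rightarrow>\<^sub>L real" and \<alpha> where \<phi>: "norm \<phi> = 1" "\<alpha> > 0" "S = slice \<phi> \<alpha>"
    using S by (auto simp: slices_def)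
  have "\<exists>\<psi> :: 'a lipfree \<Rightarrow>\<^sub>L real. norm \<psi> \<le> 1 \<and> blinfun_apply \<psi> \<mu> > 1 - e / 2"
  proof (rule ccontr)
    assume "\<not> ?thesis"
    then have "norm \<mu> \<le> 1 - e / 2" by (intro norm_lipfree_le) force
    with \<mu> \<open>e > 0\<close> show False by simp
  qed
  then obtain \<psi> :: "'a lipfree \<Rightarrow>\<^sub>L real" where \<psi>: "norm \<psi> \<le> 1" "\<psi> \<mu> > 1 - e / 2" by blast
  obtain \<eta> where \<eta>: "\<eta> > 0" and approx: "\<And>\<phi> \<psi> :: 'a lipfree \<Rightarrow>\<^sub>L real. norm \<phi> \<le> 1 \<Longrightarrow> norm \<psi> \<le> 1 \<Longrightarrow>
    (\<And>p. \<bar>blinfun_apply \<phi> (point_mass p) - blinfun_apply \<psi> (point_mass p)\<bar> \<le> \<eta>) \<Longrightarrow>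
    \<bar>blinfun_apply \<phi> \<mu> - blinfun_apply \<psi> \<mu>\<bar> \<le> e / 2"
    using pointwise_close_functionals[of "e / 2" \<mu>] \<open>e > 0\<close> by auto
  define c where "c = max 0 (1 - \<alpha>)"
  have c: "0 \<le> c" "1 - \<alpha> \<le> c" "c < norm \<phi>" using \<phi> by (auto simp: c_def)
  have "infinite {s. steep_at (\<lambda>p. \<phi> (point_mass p)) c s}"
    by (rule infinite_steep_points_functional[OF len c(1,3)])
  then obtain s where "steep_at (\<lambda>p. \<phi> (point_mass p)) c s" using infinite_imp_nonempty by blast
  moreover have "\<eta> / 4 / 4 > 0" using \<eta> by simp
  ultimately obtain u v where uv: "u \<in> ball s (\<eta> / 4 / 4)" "v \<in> ball s (\<eta> / 4 / 4)"
    "\<phi> (point_mass u) - \<phi> (point_mass v) > c * dist u v"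
    unfolding steep_at_def by blast
  note mol = molecule_in_slice[OF c(1,2) uv(3)]
  define g where "g p = \<psi> (point_mass p)" for p
  have g: "g p - g q \<le> dist p q" for p q unfolding g_def by (rule functional_lipschitz[OF \<psi>(1)])
  define h where "h p = soft_threshold (\<eta> / 4) (g p - g s) + max 0 (dist u v - dist p v)" for p
  have \<eta>4: "\<eta> / 4 > 0" using \<eta> by simp
  note dip = flat_with_dip[OF g \<eta>4 uv(1,2), folded h_def]
  obtain \<xi> :: "'a lipfree \<Rightarrow>\<^sub>L real" where \<xi>: "norm \<xi> \<le> 1" "\<And>p. blinfun_apply \<xi> (point_mass p) = h p - h 0"
    using functional_of_lipschitz[of 1 h] dip(1) by auto
  have "\<bar>\<xi> (point_mass p) - \<psi> (point_mass p)\<bar> \<le> \<eta>" for p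
  proof -
    have "\<xi> (point_mass p) - \<psi> (point_mass p) = (h p - (g p - g s)) - (h 0 - (g 0 - g s))"
      by (simp add: \<xi>(2) g_def)
    then show ?thesis
      using dip(3)[of p] dip(3)[of 0] abs_triangle_ineq4[of "h p - (g p - g s)" "h 0 - (g 0 - g s)"]
      by simp
  qed
  then have "\<bar>\<xi> \<mu> - \<psi> \<mu>\<bar> \<le> e / 2" by (rule approx[OF \<xi>(1) \<psi>(1)])
  moreover have "\<xi> (molecule u v) = - 1"
    using dip(2) mol(2) by (simp add: functional_molecule \<xi>(2))
  ultimately have "2 - e \<le> \<xi> (\<mu> - molecule u v)" using \<psi>(2) unfolding blinfun.diff_right by linarith
  also have "\<dots> \<le> norm (\<mu> - molecule u v)" by (rule functional_le_norm[OF \<xi>(1)])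
  finally show "\<exists>y\<in>S. norm (\<mu> - y) \<ge> 2 - e" using mol(1) \<phi>(3) by blast
qed

lemma infinite_sets_distinct_representatives:
  assumes "\<And>i. i < (n::nat) \<Longrightarrow> infinite (A i)"
  shows "\<exists>s. inj_on s {..<n} \<and> (\<forall>i<n. s i \<in> A i)"
  using assms
proof (induction n)
  case (Suc n)
  then obtain s where s: "inj_on s {..<n}" "\<forall>i<n. s i \<in> A i" by auto
  obtain a where a: "a \<in> A n" "a \<notin> s ` {..<n}"
    using Suc.prems[of n] by (metis finite_imageI finite_lessThan finite_subset lessI subsetI)
  have "inj_on (s(n := a)) {..<Suc n}"
    using s(1) a(2) by (auto simp: inj_on_def lessThan_Suc)
  moreover have "\<forall>i<Suc n. (s(n := a)) i \<in> A i" using s(2) a(1) by (auto simp: less_Suc_eq)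
  ultimately show ?case by blast
qed simp

lemma finite_points_separated:
  fixes s :: "nat \<Rightarrow> 'a::metric_space"
  assumes "inj_on s {..<n}"
  obtains r where "r > 0" "\<And>i j. i < n \<Longrightarrow> j < n \<Longrightarrow> i \<noteq> j \<Longrightarrow> r \<le> dist (s i) (s j)"
proof -
  define D where "D = insert 1 ((\<lambda>(i, j). dist (s i) (s j)) ` {(i, j). i < n \<and> j < n \<and> i \<noteq> j})"
  have "finite {(i, j). i < n \<and> j < n \<and> i \<noteq> j}"
    by (rule finite_subset[of _ "{..<n} \<times> {..<n}"]) auto
  then have fin: "finite D" "D \<noteq> {}" by (auto simp: D_def)
  show ?thesis
  proof (rule that[of "Min D"])
    have "\<forall>d\<in>D. d > 0" using assms by (auto simp: D_def inj_on_def)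
    then show "Min D > 0" using fin by simp
    show "Min D \<le> dist (s i) (s j)" if "i < n" "j < n" "i \<noteq> j" for i j
      using that fin by (intro Min_le) (auto simp: D_def)
  qed
qed

text \<open>The maximum of 1-Lipschitz cones of height \<open>d k\<close> with apex \<open>c k\<close>. The hypotheses say that no cone
other than that of the point itself reaches the point in question.\<close>

lemma maximum_of_bumps:
  fixes c :: "nat \<Rightarrow> 'a::metric_space" and d :: "nat \<Rightarrow> real"
  obtains h where "\<And>p q. h p - h q \<le> dist p q"
    "\<And>j. j < n \<Longrightarrow> 0 \<le> d j \<Longrightarrow> (\<And>k. k < n \<Longrightarrow> k \<noteq> j \<Longrightarrow> d k \<le> dist (c j) (c k)) \<Longrightarrow> h (c j) = d j"
    "\<And>p. (\<And>k. k < n \<Longrightarrow> d k \<le> dist p (c k)) \<Longrightarrow> h p = 0"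
proof -
  define h where "h p = Max (insert 0 ((\<lambda>k. d k - dist p (c k)) ` {..<n}))" for p
  show ?thesis
  proof (rule that[of h])
    fix p q
    have "h p \<le> h q + dist p q"
      unfolding h_def[of p]
    proof (rule Max.boundedI)
      fix x assume "x \<in> insert 0 ((\<lambda>k. d k - dist p (c k)) ` {..<n})"
      then consider "x = 0" | k where "k < n" "x = d k - dist p (c k)" by blast
      then show "x \<le> h q + dist p q"
      proof cases
        case 1
        have "0 \<le> h q" unfolding h_def by (intro Max_ge) auto
        with 1 show ?thesis by simp
      next
        case 2
        have "d k - dist q (c k) \<le> h q" unfolding h_def using 2 by (intro Max_ge) auto
        then show ?thesis using 2 dist_triangle3[of q "c k" p] by simp
      qed
    qed auto
    then show "h p - h q \<le> dist p q" by simp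
  next
    fix j assume j: "j < n" "0 \<le> d j" "\<And>k. k < n \<Longrightarrow> k \<noteq> j \<Longrightarrow> d k \<le> dist (c j) (c k)"
    have "d k - dist (c j) (c k) \<le> d j" if "k < n" for k
      using j(2) j(3)[OF that] by (cases "k = j") auto
    then show "h (c j) = d j" unfolding h_def
      using j by (intro Max_eqI) (auto intro!: image_eqI[of _ _ j])
  next
    fix p assume "\<And>k. k < n \<Longrightarrow> d k \<le> dist p (c k)"
    then show "h p = 0" unfolding h_def by (intro Max_eqI) auto
  qed
qed

text \<open>The molecules have size at most \<open>r / 2\<close> and lie near points at mutual distance at least \<open>r\<close>, so cones
of height \<open>d(u i, v i)\<close> over one end point of each do not interact. Placing the apex at \<open>u i\<close> or at
\<open>v i\<close> prescribes the sign.\<close>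

lemma separated_molecules_opposite_signs:
  fixes s :: "nat \<Rightarrow> 'a::{metric_space,zero}"
  assumes sep: "\<And>i j. i < n \<Longrightarrow> j < n \<Longrightarrow> i \<noteq> j \<Longrightarrow> r \<le> dist (s i) (s j)"
    and uv: "\<And>i. i < n \<Longrightarrow> u i \<in> ball (s i) (r / 4)" "\<And>i. i < n \<Longrightarrow> v i \<in> ball (s i) (r / 4)"
      "\<And>i. i < n \<Longrightarrow> u i \<noteq> v i"
  obtains \<xi> :: "'a lipfree \<Rightarrow>\<^sub>L real" where "norm \<xi> \<le> 1"
    "\<And>i. i < n \<Longrightarrow> blinfun_apply \<xi> (molecule (u i) (v i)) = (if P i then 1 else - 1)"
proof -
  define top where "top i = (if P i then u i else v i)" for i
  define bot where "bot i = (if P i then v i else u i)" for i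
  define d where "d i = dist (u i) (v i)" for i
  have tb: "top i \<in> ball (s i) (r / 4)" "bot i \<in> ball (s i) (r / 4)" "dist (bot i) (top i) = d i" if "i < n" for i
    using uv that by (auto simp: top_def bot_def d_def dist_commute)
  have d_le: "d i \<le> r / 2" if "i < n" for i
    using uv[OF that] dist_triangle3[of "u i" "v i" "s i"] by (simp add: d_def)
  have far: "d j \<le> dist x (top j)" if "i < n" "j < n" "i \<noteq> j" "x \<in> ball (s i) (r / 4)" for i j x
    using sep[OF that(1-3)] d_le[OF that(2)] tb(1)[OF that(2)] that(4)
      dist_triangle[of "s i" "s j" x] dist_triangle[of x "s j" "top j"]
    by (simp add: dist_commute)
  obtain h where h: "\<And>p q. h p - h q \<le> dist p q"
    "\<And>j. j < n \<Longrightarrow> 0 \<le> d j \<Longrightarrow> (\<And>k. k < n \<Longrightarrow> k \<noteq> j \<Longrightarrow> d k \<le> dist (top j) (top k)) \<Longrightarrow> h (top j) = d j"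
    "\<And>p. (\<And>k. k < n \<Longrightarrow> d k \<le> dist p (top k)) \<Longrightarrow> h p = 0"
    using maximum_of_bumps[of n d top] by metis
  have h_top: "h (top i) = d i" if "i < n" for i
    using that tb far[OF that] by (intro h(2)) (auto simp: d_def)
  have h_bot: "h (bot i) = 0" if "i < n" for i
  proof (rule h(3))
    show "d k \<le> dist (bot i) (top k)" if "k < n" for k
      using far[OF \<open>i < n\<close> that, of "bot i"] tb[OF \<open>i < n\<close>] by (cases "k = i") auto
  qed
  obtain \<xi> :: "'a lipfree \<Rightarrow>\<^sub>L real" where \<xi>: "norm \<xi> \<le> 1" "\<And>p. blinfun_apply \<xi> (point_mass p) = h p - h 0"
    using functional_of_lipschitz[of 1 h] h(1) by auto
  have "\<xi> (molecule (u i) (v i)) = (if P i then 1 else - 1)" if "i < n" for i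
    using h_top[OF that] h_bot[OF that] uv(3)[OF that]
    by (auto simp: functional_molecule \<xi>(2) top_def bot_def d_def)
  with \<xi>(1) show ?thesis by (rule that)
qed

text \<open>Indices \<open>i\<close> and \<open>n + i\<close> belong to the slice \<open>S i\<close>: the first \<open>n\<close> molecules make up one of the two
points, the last \<open>n\<close> the other.\<close>

theorem length_space_imp_ASD2P:
  assumes len: "length_space TYPE('a::{metric_space,zero})"
  shows "ASD2P TYPE('a lipfree)"
  unfolding ASD2P_def
proof
  fix C :: "'a lipfree set" assume C: "C \<in> convex_combinations_of_slices"
  then obtain n c S where c: "\<And>i. i < n \<Longrightarrow> c i > 0" "(\<Sum>i<n. c i) = (1::real)"
    and S: "\<And>i. i < (n::nat) \<Longrightarrow> S i \<in> slices" and CS: "C = {\<Sum>i<n. c i *\<^sub>R x i |x. \<forall>i<n. x i \<in> S i}"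
    unfolding convex_combinations_of_slices_def by blast
  have "\<exists>\<phi> \<alpha>. norm \<phi> = 1 \<and> \<alpha> > 0 \<and> S i = slice \<phi> \<alpha>" if "i < n" for i
    using S[OF that] by (auto simp: slices_def)
  then obtain \<phi> :: "nat \<Rightarrow> 'a lipfree \<Rightarrow>\<^sub>L real" and \<alpha> where
    \<phi>: "\<And>i. i < n \<Longrightarrow> norm (\<phi> i) = 1" "\<And>i. i < n \<Longrightarrow> \<alpha> i > 0" "\<And>i. i < n \<Longrightarrow> S i = slice (\<phi> i) (\<alpha> i)"
    by metis
  define f where "f i p = \<phi> (i mod n) (point_mass p)" for i p
  define k where "k i = max 0 (1 - \<alpha> (i mod n))" for i
  have "n > 0" using c(2) by (cases n) auto
  have inf: "infinite {s. steep_at (f i) (k i) s}" for i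
    unfolding f_def using \<phi>(1,2)[of "i mod n"] \<open>n > 0\<close>
    by (intro infinite_steep_points_functional[OF len]) (auto simp: k_def)
  obtain s where s: "inj_on s {..<2 * n}" "\<And>i. i < 2 * n \<Longrightarrow> steep_at (f i) (k i) (s i)"
    using infinite_sets_distinct_representatives[of "2 * n" "\<lambda>i. {s. steep_at (f i) (k i) s}"] inf by auto
  obtain r where r: "r > 0" "\<And>i j. i < 2 * n \<Longrightarrow> j < 2 * n \<Longrightarrow> i \<noteq> j \<Longrightarrow> r \<le> dist (s i) (s j)"
    using finite_points_separated[OF s(1)] by blast
  have "\<exists>u v. u \<in> ball (s i) (r / 4) \<and> v \<in> ball (s i) (r / 4) \<and> f i u - f i v > k i * dist u v"
    if "i < 2 * n" for i
  proof -
    have "r / 4 > 0" using r(1) by simp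
    with s(2)[OF that] show ?thesis unfolding steep_at_def by blast
  qed
  then obtain u v where uv: "\<And>i. i < 2 * n \<Longrightarrow> u i \<in> ball (s i) (r / 4)" "\<And>i. i < 2 * n \<Longrightarrow> v i \<in> ball (s i) (r / 4)"
    "\<And>i. i < 2 * n \<Longrightarrow> f i (u i) - f i (v i) > k i * dist (u i) (v i)" by metis
  have mol: "molecule (u i) (v i) \<in> S (i mod n)" "u i \<noteq> v i" if "i < 2 * n" for i
  proof -
    have "0 \<le> k i" "1 - \<alpha> (i mod n) \<le> k i" by (simp_all add: k_def)
    moreover have "\<phi> (i mod n) (point_mass (u i)) - \<phi> (i mod n) (point_mass (v i)) > k i * dist (u i) (v i)"
      using uv(3)[OF that] unfolding f_def .
    ultimately have "molecule (u i) (v i) \<in> slice (\<phi> (i mod n)) (\<alpha> (i mod n))" "u i \<noteq> v i"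
      by (rule molecule_in_slice)+
    then show "molecule (u i) (v i) \<in> S (i mod n)" "u i \<noteq> v i"
      using \<phi>(3)[of "i mod n"] \<open>n > 0\<close> by simp_all
  qed
  obtain \<xi> :: "'a lipfree \<Rightarrow>\<^sub>L real" where \<xi>: "norm \<xi> \<le> 1"
    "\<And>i. i < 2 * n \<Longrightarrow> blinfun_apply \<xi> (molecule (u i) (v i)) = (if i < n then 1 else - 1)"
    using separated_molecules_opposite_signs[where n = "2 * n" and r = r and s = s and u = u and v = v
        and P = "\<lambda>i. i < n", OF r(2) uv(1,2) mol(2)] by blast
  define x where "x = (\<Sum>i<n. c i *\<^sub>R molecule (u i) (v i))"
  define y where "y = (\<Sum>i<n. c i *\<^sub>R molecule (u (n + i)) (v (n + i)))"
  have rep: "molecule (u i) (v i) \<in> S i" "molecule (u (n + i)) (v (n + i)) \<in> S i" if "i < n" for i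
    using mol(1)[of i] mol(1)[of "n + i"] that by simp_all
  have "x \<in> C" unfolding CS x_def
    using rep(1) by (intro CollectI exI[of _ "\<lambda>i. molecule (u i) (v i)"] conjI refl allI impI)
  have "y \<in> C" unfolding CS y_def
    using rep(2) by (intro CollectI exI[of _ "\<lambda>i. molecule (u (n + i)) (v (n + i))"] conjI refl allI impI)
  have "\<xi> x = 1" "\<xi> y = - 1"
    using c(2) by (simp_all add: x_def y_def blinfun.sum_right blinfun.scaleR_right \<xi>(2) sum_negf)
  then have "2 \<le> norm (x - y)" using functional_le_norm[OF \<xi>(1), of "x - y"] by (simp add: blinfun.diff_right)
  moreover have "norm x \<le> 1" "norm y \<le> 1"
    using convex_combination_of_slices_subset_ball[OF C] \<open>x \<in> C\<close> \<open>y \<in> C\<close> by auto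
  then have "norm (x - y) \<le> 2" using norm_triangle_ineq4[of x y] by linarith
  ultimately show "\<exists>x\<in>C. \<exists>y\<in>C. norm (x - y) = 2" using \<open>x \<in> C\<close> \<open>y \<in> C\<close> by force
qed

section \<open>The local diameter two property and points almost between two points\<close>

text \<open>The point \<open>z\<close> lies between \<open>x\<close> and \<open>y\<close> up to an error that is small even relative to its distance
from the nearer of the two. It may lie very close to one of them, so a single such point does not
bring \<open>x\<close> and \<open>y\<close> substantially closer.\<close>

definition property_Z :: "'a::metric_space itself \<Rightarrow> bool" where
  "property_Z _ \<longleftrightarrow> (\<forall>x y :: 'a. x \<noteq> y \<longrightarrow> (\<forall>\<epsilon>>0. \<exists>z. z \<noteq> x \<and> z \<noteq> y \<and>
     dist x z + dist z y \<le> dist x y + \<epsilon> * min (dist x z) (dist z y)))"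

text \<open>If no point is almost between \<open>x\<close> and \<open>y\<close>, then walking from \<open>x\<close> a distance \<open>s\<close> (less than about half
way) brings one closer to \<open>y\<close> by at most \<open>(1 - \<epsilon> / 2) s\<close>. Two opposite cones at \<open>x\<close> and \<open>y\<close> of
height \<open>d(x, y) / 2\<close> and slope slightly less than 1 therefore have a difference whose slope exceeds
\<open>1 - \<epsilon> / 8\<close> only from a point \<open>u\<close> of the cone at \<open>x\<close> to a point \<open>v\<close> of the cone at \<open>y\<close>, and there it
loses an amount proportional to the displacement of \<open>(u, v)\<close> from \<open>(x, y)\<close>.\<close>

lemma peak_function:
  fixes x y :: "'a::metric_space"
  assumes "x \<noteq> y" and \<epsilon>: "0 < \<epsilon>" "\<epsilon> \<le> 1"
    and gap: "\<And>z. dist x y + \<epsilon> * min (dist x z) (dist z y) \<le> dist x z + dist z y"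
  obtains f :: "'a \<Rightarrow> real" where "f x - f y = dist x y"
    "\<And>u v. f u - f v \<le> (1 - \<epsilon> / 8) * dist u v \<or> f u - f v \<le> dist u v - \<epsilon> / 8 * (dist u x + dist v y)"
proof -
  define d a where "d = dist x y" and "a = 1 - \<epsilon> / 8"
  have d: "d > 0" using \<open>x \<noteq> y\<close> by (simp add: d_def)
  have a: "7 / 8 \<le> a" "a < 1" using \<epsilon> by (auto simp: a_def)
  define A where "A z = max 0 (d / 2 - a * dist z x)" for z
  define B where "B z = max 0 (d / 2 - a * dist z y)" for z
  have A_lip: "A u - A v \<le> a * dist u v" for u v
  proof -
    have "a * dist v x \<le> a * dist u v + a * dist u x"
      unfolding distrib_left[symmetric] using a dist_triangle3[of v x u] by (intro mult_left_mono) auto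
    moreover have "0 \<le> a * dist u v" using a by simp
    ultimately show ?thesis by (auto simp: A_def max_def)
  qed
  have B_lip: "B u - B v \<le> a * dist u v" for u v
  proof -
    have "a * dist v y \<le> a * dist u v + a * dist u y"
      unfolding distrib_left[symmetric] using a dist_triangle3[of v y u] by (intro mult_left_mono) auto
    moreover have "0 \<le> a * dist u v" using a by simp
    ultimately show ?thesis by (auto simp: B_def max_def)
  qed
  have far: "d - (1 - \<epsilon> / 2) * dist z p \<le> dist z q"
    if pq: "(p, q) = (x, y) \<or> (p, q) = (y, x)" and near: "a * dist z p < d / 2" for z p q
  proof -
    have sum: "d + \<epsilon> * min (dist z p) (dist z q) \<le> dist z p + dist z q"
      using gap[of z] pq by (auto simp: d_def dist_commute min.commute)
    have "7 / 8 * dist z p \<le> a * dist z p" using a by (intro mult_right_mono) auto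
    with near have "dist z p < 4 / 7 * d" by simp
    moreover have "0 \<le> \<epsilon> * min (dist z p) (dist z q)" using \<epsilon> by simp
    ultimately have "dist z p / 2 \<le> min (dist z p) (dist z q)" using sum d by simp
    then have "\<epsilon> * (dist z p / 2) \<le> \<epsilon> * min (dist z p) (dist z q)" using \<epsilon> by (intro mult_left_mono) auto
    with sum show ?thesis by (simp add: left_diff_distrib)
  qed
  define f where "f z = A z - B z" for z
  show ?thesis
  proof (rule that[of f])
    have "7 / 8 * d \<le> a * d" using a d by (intro mult_right_mono) auto
    then show "f x - f y = dist x y" using d by (simp add: f_def A_def B_def max_def dist_commute[of y x] flip: d_def)
    fix u v
    show "f u - f v \<le> (1 - \<epsilon> / 8) * dist u v \<or> f u - f v \<le> dist u v - \<epsilon> / 8 * (dist u x + dist v y)"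
    proof (cases "A u > 0 \<and> B v > 0")
      case True
      then have AB: "A u = d / 2 - a * dist u x" "B v = d / 2 - a * dist v y"
        by (auto simp: A_def B_def max_def split: if_splits)
      have "d - (1 - \<epsilon> / 2) * dist u x \<le> dist u y" "d - (1 - \<epsilon> / 2) * dist v y \<le> dist v x"
        using True AB by (auto intro!: far)
      then have "2 * d - (1 - \<epsilon> / 2) * (dist u x + dist v y) \<le> 2 * dist u v + (dist u x + dist v y)"
        using dist_triangle[of u y v] dist_triangle3[of v x u] by (simp add: distrib_left)
      then have "d - (1 - \<epsilon> / 4) * (dist u x + dist v y) \<le> dist u v" by (simp add: left_diff_distrib)
      moreover have "f u - f v \<le> d - a * (dist u x + dist v y)"
      proof -
        have "A v \<ge> 0" "B u \<ge> 0" by (auto simp: A_def B_def)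
        then show ?thesis by (simp add: f_def AB distrib_left)
      qed
      ultimately show ?thesis by (simp add: a_def left_diff_distrib)
    next
      case False
      moreover have "A v \<ge> 0" "B u \<ge> 0" "A u \<ge> 0" "B v \<ge> 0" by (auto simp: A_def B_def)
      ultimately have "f u - f v \<le> A u - A v \<or> f u - f v \<le> B v - B u" by (auto simp: f_def)
      then have "f u - f v \<le> a * dist u v"
        using A_lip[of u v] B_lip[of v u] by (auto simp: dist_commute)
      then show ?thesis by (simp add: a_def)
    qed
  qed
qed

text \<open>Let \<open>f\<close> be the peak function and \<open>m\<close> the molecule of \<open>x\<close> and \<open>y\<close>. Perturbing \<open>f\<close> by \<open>t g\<close> with \<open>g\<close>
1-Lipschitz raises the norm at most to \<open>1 + t g(m)\<close>, because the decay of the slopes of \<open>f\<close> away from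
\<open>(x, y)\<close> dominates the variation of the slopes of \<open>g\<close>. Thus the norm is differentiable at \<open>f\<close> with
derivative \<open>m\<close>, uniformly in \<open>g\<close>, and the slices defined by \<open>f\<close> shrink to \<open>m\<close>.\<close>

lemma small_slice_of_gap:
  fixes x y :: "'a::{metric_space,zero}"
  assumes "x \<noteq> y" and \<epsilon>: "0 < \<epsilon>" "\<epsilon> \<le> 1"
    and gap: "\<And>z. dist x y + \<epsilon> * min (dist x z) (dist z y) \<le> dist x z + dist z y"
  shows "\<exists>S\<in>(slices :: 'a lipfree set set). diameter S \<le> 1"
proof -
  define \<kappa> where "\<kappa> = \<epsilon> / 8"
  have \<kappa>: "0 < \<kappa>" "\<kappa> < 1" using \<epsilon> by (auto simp: \<kappa>_def)
  obtain f :: "'a \<Rightarrow> real" where f_xy: "f x - f y = dist x y" and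
    f: "\<And>u v. f u - f v \<le> (1 - \<kappa>) * dist u v \<or> f u - f v \<le> dist u v - \<kappa> * (dist u x + dist v y)"
    using peak_function[OF assms] unfolding \<kappa>_def by metis
  have f_lip: "f u - f v \<le> 1 * dist u v" for u v
  proof -
    have "0 \<le> \<kappa> * dist u v" "0 \<le> \<kappa> * (dist u x + dist v y)" using \<kappa> by simp_all
    then show ?thesis using f[of u v] by (auto simp: left_diff_distrib)
  qed
  obtain \<phi> :: "'a lipfree \<Rightarrow>\<^sub>L real" where \<phi>: "norm \<phi> \<le> 1" "\<And>p. \<phi> (point_mass p) = f p - f 0"
    using functional_of_lipschitz[OF _ f_lip] by auto
  define m where "m = molecule x y"
  have m: "norm m \<le> 1" "\<phi> m = 1"
    using norm_molecule_le f_xy \<open>x \<noteq> y\<close> by (auto simp: m_def functional_molecule \<phi>)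
  have "\<phi> m \<le> norm \<phi> * norm m" using norm_blinfun[of \<phi> m] m(2) by simp
  also have "\<dots> \<le> norm \<phi>" using m(1) by (simp add: mult_left_le)
  finally have "norm \<phi> = 1" using \<phi>(1) m(2) by simp
  \<comment> \<open>With this choice \<open>1 - \<kappa> + t = 1 - t\<close>: a slope of \<open>f\<close> up to \<open>1 - \<kappa>\<close> remains below
    \<open>1 + t \<psi>(m)\<close> after the perturbation, since \<open>\<psi>(m) \<ge> - 1\<close>.\<close>
  define t where "t = \<kappa> / 2"
  have t: "t > 0" using \<kappa> by (simp add: t_def)
  have close: "norm (\<mu> - m) \<le> 1 / 2" if \<mu>: "\<mu> \<in> slice \<phi> (t / 2)" for \<mu>
  proof (rule norm_lipfree_le)
    fix \<psi> :: "'a lipfree \<Rightarrow>\<^sub>L real" assume \<psi>: "norm \<psi> \<le> 1"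
    define g where "g p = \<psi> (point_mass p)" for p
    have g_lip: "g p - g q \<le> dist p q" for p q
      unfolding g_def by (rule functional_lipschitz[OF \<psi>])
    have gm: "g x - g y = \<psi> m * dist x y"
      using \<open>x \<noteq> y\<close> by (simp add: m_def functional_molecule g_def)
    have "\<bar>\<psi> m\<bar> \<le> 1"
      using norm_blinfun[of \<psi> m] mult_mono[OF \<psi> m(1)] by simp
    have "t * (1 + \<psi> m) \<ge> 0" using t \<open>\<bar>\<psi> m\<bar> \<le> 1\<close> by (intro mult_nonneg_nonneg) auto
    have c: "0 \<le> 1 + t * \<psi> m" "1 - \<kappa> + t \<le> 1 + t * \<psi> m"
      using \<open>t * (1 + \<psi> m) \<ge> 0\<close> \<kappa> by (auto simp: t_def distrib_left)
    have "norm (\<phi> + t *\<^sub>R \<psi>) \<le> 1 + t * \<psi> m"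
    proof (rule norm_functional_le[OF c(1)])
      fix u v :: 'a
      have "f u - f v + t * (g u - g v) \<le> (1 + t * \<psi> m) * dist u v"
        using f[of u v]
      proof
        assume "f u - f v \<le> (1 - \<kappa>) * dist u v"
        moreover have "t * (g u - g v) \<le> t * dist u v" using t g_lip by (intro mult_left_mono) auto
        ultimately have "f u - f v + t * (g u - g v) \<le> (1 - \<kappa> + t) * dist u v"
          by (simp add: distrib_right)
        also have "\<dots> \<le> (1 + t * \<psi> m) * dist u v" using c by (intro mult_right_mono) auto
        finally show ?thesis .
      next
        define \<sigma> where "\<sigma> = dist u x + dist v y"
        assume "f u - f v \<le> dist u v - \<kappa> * (dist u x + dist v y)"
        moreover have "t * (g u - g v) \<le> t * (\<psi> m * dist u v + 2 * \<sigma>)"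
        proof (rule mult_left_mono)
          have "g u - g v \<le> \<psi> m * dist x y + \<sigma>"
            using g_lip[of u x] g_lip[of y v] gm by (simp add: \<sigma>_def dist_commute)
          also have "\<psi> m * dist x y \<le> \<psi> m * dist u v + \<sigma>"
          proof -
            have "\<bar>dist x y - dist u v\<bar> \<le> \<sigma>"
              using dist_triangle[of x y u] dist_triangle[of u y v] dist_triangle[of u v x] dist_triangle[of x v y]
              by (simp add: \<sigma>_def dist_commute abs_le_iff)
            then have "\<bar>\<psi> m\<bar> * \<bar>dist x y - dist u v\<bar> \<le> 1 * \<sigma>"
              using \<open>\<bar>\<psi> m\<bar> \<le> 1\<close> by (intro mult_mono) auto
            then have "\<psi> m * (dist x y - dist u v) \<le> \<sigma>" by (simp flip: abs_mult)
            then show ?thesis by (simp add: right_diff_distrib)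
          qed
          finally show "g u - g v \<le> \<psi> m * dist u v + 2 * \<sigma>" by simp
        qed (use t in simp)
        moreover have "t * (2 * \<sigma>) = \<kappa> * \<sigma>" by (simp add: t_def)
        ultimately show ?thesis by (simp add: \<sigma>_def algebra_simps)
      qed
      then show "(\<phi> + t *\<^sub>R \<psi>) (point_mass u) - (\<phi> + t *\<^sub>R \<psi>) (point_mass v) \<le> (1 + t * \<psi> m) * dist u v"
        by (simp add: blinfun.add_left blinfun.scaleR_left \<phi> g_def algebra_simps)
    qed
    moreover have "(\<phi> + t *\<^sub>R \<psi>) \<mu> \<le> norm (\<phi> + t *\<^sub>R \<psi>)"
    proof -
      have "(\<phi> + t *\<^sub>R \<psi>) \<mu> \<le> norm (\<phi> + t *\<^sub>R \<psi>) * norm \<mu>" using norm_blinfun[of "\<phi> + t *\<^sub>R \<psi>" \<mu>] by simp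
      also have "\<dots> \<le> norm (\<phi> + t *\<^sub>R \<psi>)" using \<mu> by (simp add: slice_def mult_left_le)
      finally show ?thesis .
    qed
    ultimately have "\<phi> \<mu> + t * \<psi> \<mu> \<le> 1 + t * \<psi> m" by (simp add: blinfun.add_left blinfun.scaleR_left)
    moreover have "1 - t / 2 < \<phi> \<mu>" using \<mu> by (simp add: slice_def)
    ultimately have "t * (\<psi> \<mu> - \<psi> m) \<le> t * (1 / 2)" by (simp add: right_diff_distrib)
    then show "\<psi> (\<mu> - m) \<le> 1 / 2" using t by (simp add: blinfun.diff_right)
  qed
  have "slice \<phi> (t / 2) \<in> slices" unfolding slices_def using \<open>norm \<phi> = 1\<close> t
    by (intro CollectI exI[of _ \<phi>] exI[of _ "t / 2"]) simp
  moreover have "diameter (slice \<phi> (t / 2)) \<le> 1"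
  proof (rule diameter_le)
    fix \<mu> \<nu> assume "\<mu> \<in> slice \<phi> (t / 2)" "\<nu> \<in> slice \<phi> (t / 2)"
    then show "norm (\<mu> - \<nu>) \<le> 1"
      using close[of \<mu>] close[of \<nu>] norm_triangle_ineq4[of "\<mu> - m" "\<nu> - m"] by simp
  qed simp
  ultimately show ?thesis by blast
qed

theorem LD2P_imp_property_Z:
  assumes "LD2P TYPE('a::{metric_space,zero} lipfree)"
  shows "property_Z TYPE('a)"
  unfolding property_Z_def
proof (intro allI impI, rule ccontr)
  fix x y :: 'a and \<epsilon> :: real
  assume xy: "x \<noteq> y" "\<epsilon> > 0" and none: "\<nexists>z. z \<noteq> x \<and> z \<noteq> y \<and>
     dist x z + dist z y \<le> dist x y + \<epsilon> * min (dist x z) (dist z y)"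
  have "dist x y + min \<epsilon> 1 * min (dist x z) (dist z y) \<le> dist x z + dist z y" for z
  proof (cases "z = x \<or> z = y")
    case False
    have "min \<epsilon> 1 * min (dist x z) (dist z y) \<le> \<epsilon> * min (dist x z) (dist z y)"
      by (intro mult_right_mono) auto
    moreover have "dist x y + \<epsilon> * min (dist x z) (dist z y) < dist x z + dist z y"
      using none False by force
    ultimately show ?thesis by linarith
  qed auto
  then obtain S :: "'a lipfree set" where "S \<in> slices" "diameter S \<le> 1"
    using small_slice_of_gap[of x y "min \<epsilon> 1"] xy by auto
  with assms show False unfolding LD2P_def by force
qed

section \<open>Complete spaces with property (Z) have approximate midpoints\<close>

text \<open>Ekeland's variational principle. It is stated for a function \<open>\<rho>\<close> dominating the distance because
the application needs the sum of the distances of the two coordinates on pairs of points: the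
Euclidean product distance would cost a factor that the descent argument cannot afford.\<close>

lemma ekeland:
  fixes \<phi> :: "'a::complete_space \<Rightarrow> real" and \<rho> :: "'a \<Rightarrow> 'a \<Rightarrow> real"
  assumes S: "closed S" "p \<in> S" and \<phi>: "continuous_on UNIV \<phi>" "\<And>q. 0 \<le> \<phi> q"
    and \<rho>: "\<And>q. continuous_on UNIV (\<rho> q)" "\<And>q. \<rho> q q = 0" "\<And>q s. dist q s \<le> \<rho> q s"
      "\<And>q s t. \<rho> q t \<le> \<rho> q s + \<rho> s t"
  shows "\<exists>q\<in>S. \<phi> q + \<rho> p q \<le> \<phi> p \<and> (\<forall>s\<in>S. \<phi> s + \<rho> q s \<le> \<phi> q \<longrightarrow> s = q)"
proof -
  \<comment> \<open>\<open>R q\<close> consists of the points below \<open>q\<close> in Ekeland's order. A sequence descending in this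
    order and almost minimising \<open>\<phi>\<close> at each step converges to a minimal element.\<close>
  define R where "R q = {s\<in>S. \<phi> s + \<rho> q s \<le> \<phi> q}" for q
  have refl: "q \<in> R q" if "q \<in> S" for q using that \<rho> by (simp add: R_def)
  have trans: "t \<in> R q" if "s \<in> R q" "t \<in> R s" for q s t
    using that \<rho>(4)[of q t s] by (simp add: R_def)
  have bdd: "bdd_below (\<phi> ` A)" for A using \<phi>(2) by (intro bdd_belowI2) auto
  have step: "\<exists>s. s \<in> R q \<and> \<phi> s < Inf (\<phi> ` R q) + (1/2)^n" if "q \<in> S" for q and n :: nat
  proof -
    have "Inf (\<phi> ` R q) < Inf (\<phi> ` R q) + (1/2)^n" by simp
    then show ?thesis using refl[OF that] by (subst (asm) cInf_less_iff) (auto intro: bdd)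
  qed
  have "\<exists>X. \<forall>n. (X n \<in> S \<and> (n = 0 \<longrightarrow> X n = p)) \<and> (X (Suc n) \<in> R (X n) \<and> \<phi> (X (Suc n)) < Inf (\<phi> ` R (X n)) + (1/2)^n)"
  proof (rule dependent_nat_choice)
    show "\<exists>x. x \<in> S \<and> (0 = 0 \<longrightarrow> x = p)" using S by blast
    fix x and n :: nat assume "x \<in> S \<and> (n = 0 \<longrightarrow> x = p)"
    with step[of x n] show "\<exists>y. (y \<in> S \<and> (Suc n = 0 \<longrightarrow> y = p)) \<and> (y \<in> R x \<and> \<phi> y < Inf (\<phi> ` R x) + (1/2)^n)"
      by (auto simp: R_def)
  qed
  then obtain X where X: "\<And>n. X n \<in> S" "X 0 = p" "\<And>n. X (Suc n) \<in> R (X n)"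
    "\<And>n. \<phi> (X (Suc n)) < Inf (\<phi> ` R (X n)) + (1/2)^n" by blast
  have later: "X n \<in> R (X m)" if "m \<le> n" for m n
    using that by (induction n rule: dec_induct) (auto intro: refl X(1) trans X(3))
  have "decseq (\<lambda>n. \<phi> (X n))"
  proof (rule decseq_SucI)
    show "\<phi> (X (Suc n)) \<le> \<phi> (X n)" for n
      using X(3)[of n] order_trans[OF zero_le_dist \<rho>(3), of "X n" "X (Suc n)"] by (simp add: R_def)
  qed
  then have "Cauchy (\<lambda>n. \<phi> (X n))"
    using decseq_convergent[of "\<lambda>n. \<phi> (X n)" 0] \<phi>(2) LIMSEQ_imp_Cauchy by metis
  have "Cauchy X"
  proof (rule metric_CauchyI)
    fix e :: real assume "e > 0"
    then obtain M where M: "\<And>m n. m \<ge> M \<Longrightarrow> n \<ge> M \<Longrightarrow> dist (\<phi> (X m)) (\<phi> (X n)) < e"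
      using metric_CauchyD[OF \<open>Cauchy (\<lambda>n. \<phi> (X n))\<close>] by blast
    have close: "dist (X m) (X n) < e" if "m \<ge> M" "n \<ge> m" for m n
    proof -
      have "\<rho> (X m) (X n) \<le> \<phi> (X m) - \<phi> (X n)" using later[OF that(2)] by (simp add: R_def)
      then show ?thesis using \<rho>(3)[of "X m" "X n"] M[of m n] that by (simp add: dist_real_def)
    qed
    then have "dist (X m) (X n) < e" if "m \<ge> M" "n \<ge> M" for m n
      using that close[of m n] close[of n m] by (cases "m \<le> n") (auto simp: dist_commute)
    then show "\<exists>M. \<forall>m\<ge>M. \<forall>n\<ge>M. dist (X m) (X n) < e" by blast
  qed
  then obtain x where x: "X \<longlonglongrightarrow> x" using Cauchy_convergent convergent_def by blast
  have "x \<in> S" using closed_sequentially[OF S(1) X(1) x] .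
  have xR: "x \<in> R (X n)" for n
  proof -
    have "(\<lambda>m. \<phi> (X m) + \<rho> (X n) (X m)) \<longlonglongrightarrow> \<phi> x + \<rho> (X n) x"
      using \<phi>(1) \<rho>(1)[of "X n"] x
      by (intro tendsto_intros) (auto intro: continuous_on_tendsto_compose)
    then have "\<phi> x + \<rho> (X n) x \<le> \<phi> (X n)"
      by (rule LIMSEQ_le_const2) (use later in \<open>auto simp: R_def\<close>)
    with \<open>x \<in> S\<close> show ?thesis by (simp add: R_def)
  qed
  have "s = x" if s: "s \<in> R x" for s
  proof -
    have "\<phi> x \<le> \<phi> s"
    proof (rule LIMSEQ_le_const)
      show "(\<lambda>n. \<phi> s + (1/2)^n) \<longlonglongrightarrow> \<phi> s"
        using tendsto_add[OF tendsto_const LIMSEQ_realpow_zero[of "1/2"], of "\<phi> s"] by simp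
      have "\<phi> x \<le> \<phi> s + (1/2)^n" for n
      proof -
        have "\<phi> x \<le> \<phi> (X (Suc n))"
          using xR[of "Suc n"] order_trans[OF zero_le_dist \<rho>(3), of "X (Suc n)" x] by (simp add: R_def)
        moreover have "Inf (\<phi> ` R (X n)) \<le> \<phi> s"
          using trans[OF xR s] bdd by (intro cInf_lower) auto
        ultimately show ?thesis using X(4)[of n] by simp
      qed
      then show "\<exists>N. \<forall>n\<ge>N. \<phi> x \<le> \<phi> s + (1/2)^n" by blast
    qed
    moreover have "\<phi> s + \<rho> x s \<le> \<phi> x" using s by (simp add: R_def)
    ultimately have "dist x s \<le> 0" using \<rho>(3)[of x s] by linarith
    then show ?thesis by simp
  qed
  with xR[of 0] X(2) show ?thesis unfolding R_def by auto
qed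

text \<open>Costs of chains of points: steps longer than \<open>r\<close> are counted twice. Any two points are thus
joined by a chain costing at most twice their distance, which starts the iteration below, and a
chain of almost optimal cost cannot contain a long step.\<close>

inductive weighted_chain :: "real \<Rightarrow> 'a::metric_space \<Rightarrow> 'a \<Rightarrow> real \<Rightarrow> bool" for r where
  short: "dist u v \<le> r \<Longrightarrow> weighted_chain r u v (dist u v)"
| long: "r < dist u v \<Longrightarrow> weighted_chain r u v (2 * dist u v)"
| append: "weighted_chain r u v a \<Longrightarrow> weighted_chain r v w b \<Longrightarrow> weighted_chain r u w (a + b)"

text \<open>Ekeland's principle for the distance function on the pairs at distance at least \<open>r / 2\<close>. A minimal pair
at distance more than \<open>r\<close> could be improved by moving one of its points to the intermediate
point given by (Z); moving the nearer one keeps the distance above \<open>r / 2\<close>.\<close>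

lemma property_Z_descent:
  fixes x y :: "'a::complete_space"
  assumes Z: "property_Z TYPE('a)" and r: "0 < r" "r < dist x y" and \<epsilon>: "0 < \<epsilon>" "\<epsilon> < 1"
  obtains u v where "r / 2 \<le> dist u v" "dist u v \<le> r"
    "dist u v + (1 - \<epsilon>) * (dist x u + dist y v) \<le> dist x y"
proof -
  define S where "S = {p :: 'a \<times> 'a. r / 2 \<le> dist (fst p) (snd p)}"
  define \<rho> where "\<rho> p q = (1 - \<epsilon>) * (dist (fst p) (fst q) + dist (snd p) (snd q))" for p q :: "'a \<times> 'a"
  \<comment> \<open>Everything is divided by \<open>1 - \<epsilon>\<close> so that the perturbing term is at least the distance on pairs.\<close>
  have "\<exists>q\<in>S. (dist (fst q) (snd q) / (1 - \<epsilon>)) + \<rho> (x, y) q / (1 - \<epsilon>) \<le> dist (fst (x, y)) (snd (x, y)) / (1 - \<epsilon>) \<and>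
    (\<forall>s\<in>S. dist (fst s) (snd s) / (1 - \<epsilon>) + \<rho> q s / (1 - \<epsilon>) \<le> dist (fst q) (snd q) / (1 - \<epsilon>) \<longrightarrow> s = q)"
  proof (rule ekeland)
    show "closed S" unfolding S_def by (intro closed_Collect_le continuous_intros)
    show "(x, y) \<in> S" using r by (simp add: S_def)
    show "continuous_on UNIV (\<lambda>q :: 'a \<times> 'a. dist (fst q) (snd q) / (1 - \<epsilon>))"
      using \<epsilon> by (intro continuous_intros) auto
    show "continuous_on UNIV (\<lambda>s. \<rho> q s / (1 - \<epsilon>))" for q
      unfolding \<rho>_def using \<epsilon> by (intro continuous_intros) auto
    show "dist q s \<le> \<rho> q s / (1 - \<epsilon>)" for q s
      using \<epsilon> sqrt_sum_squares_le_sum[of "dist (fst q) (fst s)" "dist (snd q) (snd s)"]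
      by (simp add: \<rho>_def dist_prod_def)
    show "\<rho> q t / (1 - \<epsilon>) \<le> \<rho> q s / (1 - \<epsilon>) + \<rho> s t / (1 - \<epsilon>)" for q s t
      using \<epsilon> dist_triangle[of "fst q" "fst t" "fst s"] dist_triangle[of "snd q" "snd t" "snd s"]
      by (simp add: \<rho>_def)
  qed (use \<epsilon> in \<open>auto simp: \<rho>_def\<close>)
  then obtain u v where uv: "(u, v) \<in> S" "dist u v + \<rho> (x, y) (u, v) \<le> dist x y"
    and min: "\<forall>s\<in>S. dist (fst s) (snd s) + \<rho> (u, v) s \<le> dist u v \<longrightarrow> s = (u, v)"
    using \<epsilon> by (auto simp flip: add_divide_distrib simp: divide_le_cancel)
  have "dist u v \<le> r"
  proof (rule ccontr)
    assume "\<not> dist u v \<le> r"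
    with r have "u \<noteq> v" "r < dist u v" by auto
    then obtain z where z: "z \<noteq> u" "z \<noteq> v"
      "dist u z + dist z v \<le> dist u v + \<epsilon> * min (dist u z) (dist z v)"
      using Z \<epsilon>(1) unfolding property_Z_def by blast
    have "dist u v \<le> dist u z + dist z v" by (rule dist_triangle)
    consider "dist u z \<le> dist z v" | "dist z v \<le> dist u z" by linarith
    then show False
    proof cases
      case 1
      then have "(z, v) \<in> S" using \<open>r < dist u v\<close> \<open>dist u v \<le> dist u z + dist z v\<close> by (simp add: S_def)
      moreover have "dist z v + \<rho> (u, v) (z, v) \<le> dist u v"
        using z(3) 1 by (simp add: \<rho>_def min_def left_diff_distrib)
      ultimately show False using min z by force
    next
      case 2
      then have "(u, z) \<in> S" using \<open>r < dist u v\<close> \<open>dist u v \<le> dist u z + dist z v\<close> by (simp add: S_def)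
      moreover have "min (dist u z) (dist z v) = dist z v" using 2 by simp
      then have "dist u z + \<rho> (u, v) (u, z) \<le> dist u v"
        using z(3) by (simp add: \<rho>_def left_diff_distrib dist_commute)
      ultimately show False using min z by force
    qed
  qed
  with uv that[of u v] show ?thesis by (simp add: S_def \<rho>_def)
qed

text \<open>Replace \<open>(x, y)\<close> by the short pair \<open>(u, v)\<close> of the descent lemma. The total displacement \<open>\<rho>\<close> is at
most about \<open>d(x, y) - r / 2\<close>, and only this part has to be covered by chains with the excess factor \<open>\<theta>\<close>.
The number \<open>\<epsilon>\<close> is chosen so small that the loss in the descent uses up at most half of the gain.\<close>

lemma weighted_chain_improve:
  assumes Z: "property_Z TYPE('a::complete_space)" and r: "0 < r" "r \<le> D" and \<theta>: "0 < \<theta>"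
    and IH: "\<And>u v :: 'a. dist u v \<le> D \<Longrightarrow> \<exists>L. weighted_chain r u v L \<and> L \<le> (1 + \<theta>) * dist u v"
    and xy: "dist x y \<le> D"
  shows "\<exists>L. weighted_chain r (x::'a) y L \<and> L \<le> (1 + \<theta> * (1 - r / (4 * D))) * dist x y"
proof (cases "dist x y \<le> r")
  case True
  have "0 \<le> 1 - r / (4 * D)" using r by simp
  then have "0 \<le> \<theta> * (1 - r / (4 * D)) * dist x y" using \<theta> by simp
  then have "dist x y \<le> (1 + \<theta> * (1 - r / (4 * D))) * dist x y" by (simp add: distrib_right)
  with weighted_chain.short[OF True] show ?thesis by blast
next
  case False
  define c where "c = r / (4 * D)"
  have c: "0 < c" "c \<le> 1/4" using r by (auto simp: c_def field_simps)
  define \<epsilon> where "\<epsilon> = c * \<theta> / (1 + \<theta>)"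
  have "\<epsilon> \<le> c" "0 < \<epsilon>" "\<epsilon> * (1 + \<theta>) = c * \<theta>" using c \<theta> by (auto simp: \<epsilon>_def field_simps)
  then have "\<epsilon> < 1" using c by simp
  obtain u v where uv: "r / 2 \<le> dist u v" "dist u v \<le> r"
    "dist u v + (1 - \<epsilon>) * (dist x u + dist y v) \<le> dist x y"
    using property_Z_descent[OF Z r(1) _ \<open>0 < \<epsilon>\<close> \<open>\<epsilon> < 1\<close>, of x y] False by auto
  define \<rho> where "\<rho> = dist x u + dist y v"
  have "r = 4 * D * c" using r by (simp add: c_def)
  have rho_le: "(1 - \<epsilon>) * \<rho> \<le> (1 - 2 * c) * dist x y"
  proof -
    have "2 * c * dist x y \<le> 2 * c * D" using c xy by (intro mult_left_mono) auto
    also have "\<dots> \<le> dist u v" using uv(1) \<open>r = 4 * D * c\<close> by (simp add: mult.commute)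
    finally show ?thesis using uv(3) by (simp add: \<rho>_def left_diff_distrib)
  qed
  have "\<rho> \<le> D"
  proof -
    have "(1 - 2 * c) * dist x y \<le> (1 - \<epsilon>) * D"
      using c \<open>\<epsilon> \<le> c\<close> xy by (intro mult_mono) auto
    with rho_le have "(1 - \<epsilon>) * \<rho> \<le> (1 - \<epsilon>) * D" by simp
    then show ?thesis using \<open>\<epsilon> < 1\<close> by simp
  qed
  then have "dist x u \<le> D" "dist v y \<le> D"
    using zero_le_dist[of x u] zero_le_dist[of y v] by (auto simp: \<rho>_def dist_commute simp del: zero_le_dist)
  then obtain L1 L2 where L: "weighted_chain r x u L1" "L1 \<le> (1 + \<theta>) * dist x u"
    "weighted_chain r v y L2" "L2 \<le> (1 + \<theta>) * dist v y" using IH by meson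
  have "weighted_chain r x y (L1 + (dist u v + L2))"
    by (intro weighted_chain.append[OF L(1)] weighted_chain.append[OF _ L(3)] weighted_chain.short uv(2))
  moreover have "L1 + (dist u v + L2) \<le> (1 + \<theta> * (1 - c)) * dist x y"
  proof -
    have "L1 + (dist u v + L2) \<le> (1 + \<theta>) * \<rho> + dist u v"
      using L by (simp add: \<rho>_def distrib_left dist_commute)
    also have "\<dots> \<le> dist x y + (\<theta> + \<epsilon>) * \<rho>"
      using uv(3) by (simp add: \<rho>_def algebra_simps)
    also have "(\<theta> + \<epsilon>) * \<rho> \<le> \<theta> * (1 - c) * dist x y"
    proof -
      have "(1 - \<epsilon>) * ((\<theta> + \<epsilon>) * \<rho>) = (\<theta> + \<epsilon>) * ((1 - \<epsilon>) * \<rho>)" by simp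
      also have "\<dots> \<le> (\<theta> + \<epsilon>) * ((1 - 2 * c) * dist x y)"
        using rho_le \<theta> \<open>0 < \<epsilon>\<close> by (intro mult_left_mono) auto
      also have "\<dots> = ((\<theta> + \<epsilon>) * (1 - 2 * c)) * dist x y" by simp
      also have "\<dots> \<le> ((1 - \<epsilon>) * (\<theta> * (1 - c))) * dist x y"
      proof (rule mult_right_mono)
        have "(1 - \<epsilon>) * (\<theta> * (1 - c)) - (\<theta> + \<epsilon>) * (1 - 2 * c) = (c * \<theta> - \<epsilon> * (1 + \<theta>)) + \<epsilon> * c * (\<theta> + 2)"
          by (simp add: algebra_simps)
        also have "\<dots> \<ge> 0" using \<open>\<epsilon> * (1 + \<theta>) = c * \<theta>\<close> \<open>0 < \<epsilon>\<close> c \<theta> by simp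
        finally show "(\<theta> + \<epsilon>) * (1 - 2 * c) \<le> (1 - \<epsilon>) * (\<theta> * (1 - c))" by simp
      qed simp
      finally have "(1 - \<epsilon>) * ((\<theta> + \<epsilon>) * \<rho>) \<le> (1 - \<epsilon>) * (\<theta> * (1 - c) * dist x y)" by (simp add: mult.assoc)
      then show ?thesis using \<open>\<epsilon> < 1\<close> by simp
    qed
    finally show ?thesis by (simp add: algebra_simps)
  qed
  ultimately show ?thesis unfolding c_def by blast
qed

lemma short_weighted_chain:
  fixes x y :: "'a::complete_space"
  assumes Z: "property_Z TYPE('a)" and "0 < r" "0 < e"
  shows "\<exists>L. weighted_chain r x y L \<and> L < dist x y + e"
proof -
  define D where "D = max r (dist x y)"
  have D: "r \<le> D" "dist x y \<le> D" "0 < D" using assms by (auto simp: D_def)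
  define q where "q = 1 - r / (4 * D)"
  have q: "0 < q" "q < 1" using D \<open>0 < r\<close> by (auto simp: q_def field_simps)
  have chains: "\<exists>L. weighted_chain r u v L \<and> L \<le> (1 + q ^ n) * dist u v"
    if "dist u v \<le> D" for u v :: 'a and n
    using that
  proof (induction n arbitrary: u v)
    case 0
    show ?case
    proof (cases "dist u v \<le> r")
      case True
      then show ?thesis by (intro exI[of _ "dist u v"]) (simp add: weighted_chain.short)
    next
      case False
      then show ?thesis by (intro exI[of _ "2 * dist u v"]) (simp add: weighted_chain.long)
    qed
  next
    case (Suc n)
    have "0 < q ^ n" using q by simp
    from weighted_chain_improve[OF Z \<open>0 < r\<close> D(1) this Suc.IH Suc.prems]
    show ?case by (simp add: q_def mult.commute)
  qed
  have "(\<lambda>n. q ^ n * D) \<longlonglongrightarrow> 0 * D" using q by (intro tendsto_intros LIMSEQ_realpow_zero) auto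
  then have "\<forall>\<^sub>F n in sequentially. q ^ n * D < e" using \<open>0 < e\<close> by (intro order_tendstoD(2)) auto
  then obtain n where n: "q ^ n * D < e" by (auto simp: eventually_sequentially)
  obtain L where L: "weighted_chain r x y L" "L \<le> (1 + q ^ n) * dist x y" using chains[OF D(2)] by blast
  have "q ^ n * dist x y \<le> q ^ n * D" using q D by (intro mult_left_mono) auto
  with L n have "L < dist x y + e" by (simp add: distrib_right)
  with L show ?thesis by blast
qed

text \<open>Either the chain contains a long step, and then its cost exceeds the distance by \<open>r\<close>; or all steps
are at most \<open>r\<close>, and the chain can be cut at any prescribed length up to an error \<open>r\<close>.\<close>

lemma weighted_chain_split:
  assumes "weighted_chain r u v L" "0 < r"
  shows "dist u v \<le> L \<and> (dist u v + r \<le> L \<or>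
    (\<forall>a. 0 \<le> a \<and> a \<le> L \<longrightarrow> (\<exists>z. dist u z \<le> a \<and> dist z v \<le> L - a + r)))"
  using assms(1)
proof induction
  case (short u v)
  have "\<exists>z. dist u z \<le> a \<and> dist z v \<le> dist u v - a + r" if "0 \<le> a" "a \<le> dist u v" for a
    using that short by (intro exI[of _ u]) auto
  then show ?case by blast
next
  case (long u v)
  then show ?case by simp
next
  case (append u v a w b)
  have le: "dist u w \<le> dist u v + dist v w" by (rule dist_triangle)
  show ?case
  proof (cases "dist u v + r \<le> a \<or> dist v w + r \<le> b")
    case True
    then show ?thesis using append.IH le by auto
  next
    case False
    have "\<exists>z. dist u z \<le> s \<and> dist z w \<le> a + b - s + r" if s: "0 \<le> s" "s \<le> a + b" for s
    proof (cases "s \<le> a")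
      case True
      then obtain z where "dist u z \<le> s" "dist z v \<le> a - s + r" using append.IH(1) False s by blast
      then show ?thesis using dist_triangle[of z w v] append.IH(2) by (intro exI[of _ z]) auto
    next
      case sa: False
      then obtain z where "dist v z \<le> s - a" "dist z w \<le> b - (s - a) + r"
        using append.IH(2) False s by (metis add.commute diff_ge_0_iff_ge diff_le_eq less_eq_real_def not_le)
      then show ?thesis using dist_triangle[of u z v] append.IH(1) by (intro exI[of _ z]) auto
    qed
    then show ?thesis using append.IH le by auto
  qed
qed

lemma property_Z_approximate_midpoint:
  fixes x y :: "'a::complete_space"
  assumes Z: "property_Z TYPE('a)" and "0 < \<delta>"
  shows "\<exists>z. dist x z \<le> dist x y / 2 + \<delta> \<and> dist z y \<le> dist x y / 2 + \<delta>"
proof -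
  obtain L where L: "weighted_chain (\<delta> / 2) x y L" "L < dist x y + \<delta> / 2"
    using short_weighted_chain[OF Z, of "\<delta> / 2" "\<delta> / 2" x y] \<open>0 < \<delta>\<close> by auto
  have split: "dist x y \<le> L" "dist x y + \<delta> / 2 \<le> L \<or>
      (\<forall>a. 0 \<le> a \<and> a \<le> L \<longrightarrow> (\<exists>z. dist x z \<le> a \<and> dist z y \<le> L - a + \<delta> / 2))"
    using weighted_chain_split[OF L(1)] \<open>0 < \<delta>\<close> by auto
  have "0 \<le> L / 2" "L / 2 \<le> L" using split(1) zero_le_dist[of x y] by linarith+
  then obtain z where "dist x z \<le> L / 2" "dist z y \<le> L - L / 2 + \<delta> / 2"
    using split(2) L(2) by (meson not_le)
  then show ?thesis using L(2) \<open>0 < \<delta>\<close> by (intro exI[of _ z]) simp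
qed

section \<open>Complete spaces with approximate midpoints are length spaces\<close>

lemma nat_floor_double_div2:
  assumes "0 \<le> x" shows "nat \<lfloor>2 * x\<rfloor> div 2 = nat \<lfloor>x :: real\<rfloor>"
proof -
  have "\<lfloor>2 * x / of_int 2\<rfloor> = \<lfloor>2 * x\<rfloor> div 2" by (rule floor_divide_real_eq_div) simp
  then have "\<lfloor>x\<rfloor> = \<lfloor>2 * x\<rfloor> div 2" by simp
  then show ?thesis using assms by (simp add: nat_div_distrib)
qed

lemma dist_sequence_le:
  fixes X :: "nat \<Rightarrow> 'a::metric_space"
  assumes "\<And>k. dist (X k) (X (Suc k)) \<le> a" "i \<le> j"
  shows "dist (X i) (X j) \<le> real (j - i) * a"
  using assms(2)
proof (induction j rule: dec_induct)
  case (step n)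
  have "dist (X i) (X (Suc n)) \<le> dist (X i) (X n) + dist (X n) (X (Suc n))" by (rule dist_triangle)
  also have "\<dots> \<le> real (n - i) * a + a" using step.IH assms(1) by (rule add_mono)
  also have "\<dots> = real (Suc n - i) * a" using step.hyps by (simp add: Suc_diff_le algebra_simps)
  finally show ?case .
qed simp

lemma halving_steps_bound:
  fixes X :: "nat \<Rightarrow> 'a::metric_space"
  assumes "\<And>n. dist (X n) (X (Suc n)) \<le> C / 2 ^ Suc n" "m \<le> n"
  shows "dist (X m) (X n) \<le> C * (1 / 2 ^ m - 1 / 2 ^ n)"
  using assms(2)
proof (induction n rule: dec_induct)
  case (step n)
  have "dist (X m) (X (Suc n)) \<le> dist (X m) (X n) + dist (X n) (X (Suc n))" by (rule dist_triangle)
  also have "\<dots> \<le> C * (1 / 2 ^ m - 1 / 2 ^ n) + C / 2 ^ Suc n" using step.IH assms(1) by (rule add_mono)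
  also have "\<dots> = C * (1 / 2 ^ m - 1 / 2 ^ Suc n)" by (simp add: field_simps)
  finally show ?case .
qed simp

lemma Cauchy_halving_steps:
  fixes X :: "nat \<Rightarrow> 'a::metric_space"
  assumes "\<And>n. dist (X n) (X (Suc n)) \<le> C / 2 ^ Suc n" "0 \<le> C"
  shows "Cauchy X"
proof (rule metric_CauchyI)
  fix e :: real assume "e > 0"
  have "(\<lambda>n. C * (1/2) ^ n) \<longlonglongrightarrow> C * 0" by (intro tendsto_intros LIMSEQ_realpow_zero) auto
  then have "\<forall>\<^sub>F n in sequentially. C * (1/2) ^ n < e" using \<open>0 < e\<close> by (intro order_tendstoD(2)) auto
  then obtain M where M: "\<And>n. n \<ge> M \<Longrightarrow> C * (1/2) ^ n < e" by (auto simp: eventually_sequentially)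
  have close: "dist (X m) (X n) < e" if "M \<le> m" "m \<le> n" for m n
  proof -
    have "dist (X m) (X n) \<le> C * (1 / 2 ^ m - 1 / 2 ^ n)" by (rule halving_steps_bound[OF assms(1) that(2)])
    also have "\<dots> \<le> C * (1/2) ^ m" using assms(2) by (intro mult_left_mono) (auto simp: power_one_over)
    also have "\<dots> < e" using M that by simp
    finally show ?thesis .
  qed
  have "dist (X m) (X n) < e" if "m \<ge> M" "n \<ge> M" for m n
    using that close[of m n] close[of n m] by (cases "m \<le> n") (auto simp: dist_commute)
  then show "\<exists>M. \<forall>m\<ge>M. \<forall>n\<ge>M. dist (X m) (X n) < e" by blast
qed

text \<open>The curve at level \<open>n\<close> is the step function \<open>t \<mapsto> G n \<lfloor>t 2\<^sup>n\<rfloor>\<close>, which is Lipschitz up to an error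
\<open>C / 2\<^sup>n\<close>. Its limit is Lipschitz.\<close>

lemma dyadic_path:
  fixes G :: "nat \<Rightarrow> nat \<Rightarrow> 'a::complete_space"
  assumes even: "\<And>n k. G (Suc n) (2 * k) = G n k"
    and step: "\<And>n k. dist (G n k) (G n (Suc k)) \<le> C / 2 ^ n"
  obtains f :: "real \<Rightarrow> 'a" where "f 0 = G 0 0" "f 1 = G 0 1"
    "\<And>s t. s \<in> {0..1} \<Longrightarrow> t \<in> {0..1} \<Longrightarrow> dist (f s) (f t) \<le> C * \<bar>s - t\<bar>"
proof -
  have "0 \<le> C" using order_trans[OF zero_le_dist step[of 0 0]] by simp
  define g where "g n t = G n (nat \<lfloor>t * 2 ^ n\<rfloor>)" for n and t :: real
  have g_step: "dist (g n t) (g (Suc n) t) \<le> C / 2 ^ Suc n" if "0 \<le> t" for n t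
  proof -
    define m where "m = nat \<lfloor>t * 2 ^ Suc n\<rfloor>"
    have "m div 2 = nat \<lfloor>t * 2 ^ n\<rfloor>"
      using nat_floor_double_div2[of "t * 2 ^ n"] that by (simp add: m_def mult.left_commute mult.commute)
    then have "g n t = G (Suc n) (2 * (m div 2))" by (simp add: g_def even)
    moreover have "g (Suc n) t = G (Suc n) m" by (simp add: g_def m_def)
    moreover have "m = 2 * (m div 2) \<or> m = Suc (2 * (m div 2))" by presburger
    ultimately show ?thesis using step[of "Suc n" "2 * (m div 2)"] \<open>0 \<le> C\<close> by auto
  qed
  define f where "f t = lim (\<lambda>n. g n t)" for t
  have lim: "(\<lambda>n. g n t) \<longlonglongrightarrow> f t" if "0 \<le> t" for t
    unfolding f_def convergent_LIMSEQ_iff[symmetric]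
    by (intro Cauchy_convergent Cauchy_halving_steps[OF g_step[OF that] \<open>0 \<le> C\<close>])
  have g_lip: "dist (g n s) (g n t) \<le> C * \<bar>s - t\<bar> + C * (1/2) ^ n" if "0 \<le> s" "s \<le> t" for n s t
  proof -
    have "nat \<lfloor>s * 2 ^ n\<rfloor> \<le> nat \<lfloor>t * 2 ^ n\<rfloor>" using that by (intro nat_mono floor_mono mult_right_mono) auto
    then have "dist (g n s) (g n t) \<le> real (nat \<lfloor>t * 2 ^ n\<rfloor> - nat \<lfloor>s * 2 ^ n\<rfloor>) * (C / 2 ^ n)"
      unfolding g_def by (intro dist_sequence_le step)
    also have "\<dots> \<le> ((t - s) * 2 ^ n + 1) * (C / 2 ^ n)"
    proof (rule mult_right_mono)
      have "0 \<le> s * 2 ^ n" "0 \<le> t * 2 ^ n" using that by auto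
      then have "real (nat \<lfloor>t * 2 ^ n\<rfloor>) \<le> t * 2 ^ n" "s * 2 ^ n - 1 \<le> real (nat \<lfloor>s * 2 ^ n\<rfloor>)"
        by linarith+
      then show "real (nat \<lfloor>t * 2 ^ n\<rfloor> - nat \<lfloor>s * 2 ^ n\<rfloor>) \<le> (t - s) * 2 ^ n + 1"
        using \<open>nat \<lfloor>s * 2 ^ n\<rfloor> \<le> nat \<lfloor>t * 2 ^ n\<rfloor>\<close> by (simp add: left_diff_distrib)
    qed (use \<open>0 \<le> C\<close> in simp)
    also have "\<dots> = C * \<bar>s - t\<bar> + C * (1/2) ^ n" using that by (simp add: field_simps power_one_over)
    finally show ?thesis .
  qed
  have f_lip: "dist (f s) (f t) \<le> C * \<bar>s - t\<bar>" if "0 \<le> s" "s \<le> t" for s t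
  proof (rule tendsto_le[OF sequentially_bot])
    show "(\<lambda>n. dist (g n s) (g n t)) \<longlonglongrightarrow> dist (f s) (f t)"
      using that by (intro tendsto_dist lim) auto
    show "(\<lambda>n. C * \<bar>s - t\<bar> + C * (1/2) ^ n) \<longlonglongrightarrow> C * \<bar>s - t\<bar>"
      by (rule tendsto_eq_intros LIMSEQ_realpow_zero refl | simp)+
  qed (use g_lip[OF that] in simp)
  have powers: "G n 0 = G 0 0" "G n (2 ^ n) = G 0 1" for n
    using even[of _ 0] even[of _ "2 ^ _"] by (induction n) auto
  have "g n 0 = G 0 0" "g n 1 = G 0 1" for n using powers by (simp_all add: g_def nat_power_eq)
  then have "f 0 = G 0 0" "f 1 = G 0 1" by (simp_all add: f_def)
  moreover have "dist (f s) (f t) \<le> C * \<bar>s - t\<bar>" if "s \<in> {0..1}" "t \<in> {0..1}" for s t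
    using f_lip[of s t] f_lip[of t s] that by (cases "s \<le> t") (auto simp: dist_commute abs_minus_commute)
  ultimately show ?thesis using that by blast
qed

text \<open>Repeatedly insert approximate midpoints. The error allowed at level \<open>n\<close> is so small that the
constants \<open>C n\<close> in the bound \<open>C n / 2\<^sup>n\<close> for the step length increase only from \<open>d(p, q)\<close> to \<open>d(p, q) + e\<close>.\<close>

lemma midpoints_imp_length_space:
  assumes mid: "\<And>(x::'a::complete_space) y \<delta>. \<delta> > 0 \<Longrightarrow>
    \<exists>z. dist x z \<le> dist x y / 2 + \<delta> \<and> dist z y \<le> dist x y / 2 + \<delta>"
  shows "length_space TYPE('a)"
proof (rule length_spaceI)
  fix p q :: 'a and e :: real assume "e > 0"
  define \<delta> where "\<delta> n = e / 2 ^ Suc n / 2 ^ Suc n" for n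
  have "\<delta> n > 0" for n using \<open>e > 0\<close> by (simp add: \<delta>_def)
  define M where "M n x y = (SOME z. dist x z \<le> dist x y / 2 + \<delta> n \<and> dist z y \<le> dist x y / 2 + \<delta> n)"
    for n and x y :: 'a
  have M: "dist x (M n x y) \<le> dist x y / 2 + \<delta> n" "dist (M n x y) y \<le> dist x y / 2 + \<delta> n" for n x y
    using someI_ex[OF mid[OF \<open>\<delta> n > 0\<close>, of x y]] unfolding M_def by blast+
  define G where "G = rec_nat (\<lambda>k. if k = 0 then p else q)
    (\<lambda>n g k. if even k then g (k div 2) else M n (g (k div 2)) (g (Suc (k div 2))))"
  have G0: "G 0 k = (if k = 0 then p else q)" for k by (simp add: G_def)
  have even: "G (Suc n) (2 * k) = G n k" for n k by (simp add: G_def)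
  have odd: "G (Suc n) (Suc (2 * k)) = M n (G n k) (G n (Suc k))" for n k by (simp add: G_def)
  define C where "C n = dist p q + e - e / 2 ^ n" for n :: nat
  have halve: "C n / 2 ^ n / 2 + \<delta> n = C (Suc n) / 2 ^ Suc n" for n
    by (simp add: C_def \<delta>_def field_simps)
  have "dist (G n k) (G n (Suc k)) \<le> C n / 2 ^ n" for n k
  proof (induction n arbitrary: k)
    case 0
    then show ?case by (simp add: G0 C_def)
  next
    case (Suc n)
    have le: "dist (G n j) (G n (Suc j)) / 2 + \<delta> n \<le> C (Suc n) / 2 ^ Suc n" for j
      unfolding halve[symmetric] by (intro add_right_mono divide_right_mono Suc.IH) simp
    consider j where "k = 2 * j" | j where "k = Suc (2 * j)" by (metis evenE oddE Suc_eq_plus1)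
    then show ?case
    proof cases
      case 1
      then show ?thesis using M(1)[of "G n j" n "G n (Suc j)"] le[of j] by (simp only: even odd)
    next
      case (2 j)
      then have "Suc k = 2 * Suc j" by simp
      with 2 show ?thesis using M(2)[of n "G n j" "G n (Suc j)"] le[of j] by (simp only: even odd)
    qed
  qed
  moreover have "C n / 2 ^ n \<le> (dist p q + e) / 2 ^ n" for n
    using \<open>e > 0\<close> by (intro divide_right_mono) (auto simp: C_def)
  ultimately have "dist (G n k) (G n (Suc k)) \<le> (dist p q + e) / 2 ^ n" for n k
    using order_trans by blast
  from dyadic_path[where G = G, OF even this]
  obtain f :: "real \<Rightarrow> 'a" where "f 0 = G 0 0" "f 1 = G 0 1" and f_lip:
    "\<And>s t. s \<in> {0..1} \<Longrightarrow> t \<in> {0..1} \<Longrightarrow> dist (f s) (f t) \<le> (dist p q + e) * \<bar>s - t\<bar>"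
    by blast
  then have f: "f 0 = p" "f 1 = q" by (simp_all add: G0)
  have "(dist p q + e)-lipschitz_on {0..1} f"
    using f_lip \<open>e > 0\<close> by (intro lipschitz_onI) (auto simp: dist_real_def)
  then have "path f" unfolding path_def by (rule lipschitz_on_continuous_on)
  with f path_length_le_of_lipschitz[OF f_lip]
  show "\<exists>\<gamma>. path \<gamma> \<and> pathstart \<gamma> = p \<and> pathfinish \<gamma> = q \<and> path_length \<gamma> \<le> ereal (dist p q + e)"
    by (intro exI[of _ f]) (simp add: pathstart_def pathfinish_def)
qed

theorem property_Z_imp_length_space:
  assumes "property_Z TYPE('a::complete_space)"
  shows "length_space TYPE('a)"
  by (rule midpoints_imp_length_space) (rule property_Z_approximate_midpoint[OF assms])

section \<open>The equivalence\<close>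

theorem theorem1p1:
  assumes "\<exists>p q :: 'a::{complete_space,zero}. p \<noteq> q"
  shows
    "(length_space TYPE('a) \<longleftrightarrow> daugavet_property TYPE('a lipfree)) \<and>
     (length_space TYPE('a) \<longleftrightarrow> SD2P TYPE('a lipfree)) \<and>
     (length_space TYPE('a) \<longleftrightarrow> D2P TYPE('a lipfree)) \<and>
     (length_space TYPE('a) \<longleftrightarrow> LD2P TYPE('a lipfree)) \<and>
     (length_space TYPE('a) \<longleftrightarrow> ASD2P TYPE('a lipfree)) \<and>
     (length_space TYPE('a) \<longleftrightarrow> AD2P TYPE('a lipfree)) \<and>
     (length_space TYPE('a) \<longleftrightarrow> ALD2P TYPE('a lipfree))"
proof -
  \<comment> \<open>Two distinct points exclude the zero space.\<close>
  have nontriv: "\<exists>\<phi> :: 'a lipfree \<Rightarrow>\<^sub>L real. norm \<phi> = 1"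
    using assms exists_norm_one_functional by blast
  have daugavet: "length_space TYPE('a) \<Longrightarrow> daugavet_property TYPE('a lipfree)"
    by (rule length_space_imp_daugavet)
  have ASD2P: "length_space TYPE('a) \<Longrightarrow> ASD2P TYPE('a lipfree)"
    by (rule length_space_imp_ASD2P)
  have AD2P: "ASD2P TYPE('a lipfree) \<Longrightarrow> AD2P TYPE('a lipfree)"
    by (rule ASD2P_imp_AD2P[OF nontriv])
  have length: "LD2P TYPE('a lipfree) \<Longrightarrow> length_space TYPE('a)"
    by (intro property_Z_imp_length_space LD2P_imp_property_Z)
  show ?thesis
    using daugavet ASD2P AD2P length daugavet_imp_LD2P SD2P_imp_LD2P D2P_imp_LD2P
      ASD2P_imp_SD2P AD2P_imp_D2P ASD2P_imp_ALD2P ALD2P_imp_LD2P by metis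
qed

end
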